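(* Let $0<\alpha\le 1/2$. For each $\beta\in(1/2,1)$ let $F=F_{\alpha,\beta}$ be the attractor of the IFS on $[0,1]^2$ consisting of $$S_1(x,y)=(\beta x,\alpha y),\qquad S_2(x,y)=(\beta x+1-\beta,\ \alpha y+1-\alpha).$$ Then for all $\beta\in(1/2,1)$, $$1\ <\ \dim_{\mathrm A}F\ =\ 1+\frac{\log\left(2\beta^{s(\beta)}\right)}{-\log\alpha}\ <\ 1+\frac{\log2}{-\log\alpha}-\frac{\log\beta}{2\log\alpha}\ <\ 2,$$ and, for any $n\in\mathbb N$, $\dim_{\mathrm A}F\to\dim_{\mathrm B}F$ as $\beta\to2^{-1/n}$ (with $\alpha$ fixed), i.e. $\dim_{\mathrm A}F_{\alpha,\beta}-\dim_{\mathrm B}F_{\alpha,\beta}\to0$ as $\beta\to2^{-1/n}$ with $\beta\in(1/2,1)$.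
   Context: The attractor $F$ is the unique non-empty compact set with $F=S_1(F)\cup S_2(F)$. $\nu_\beta$ is the $\beta$-Bernoulli convolution rescaled to $[0,1]$: the unique Borel probability measure on $[0,1]$ with $\nu_\beta=\tfrac12\,\nu_\beta\circ f_1^{-1}+\tfrac12\,\nu_\beta\circ f_2^{-1}$, where $f_1(x)=\beta x$, $f_2(x)=\beta x+1-\beta$ (equivalently, the rescaled distribution of the random series $\sum\pm\beta^k$ with signs chosen independently with probability $1/2$ each). Define $$s(\beta)=\sup\{t:\exists C>0\text{ with }\nu_\beta(I)\le C|I|^t\text{ for all subintervals }I\subseteq[0,1]\},$$ where $|I|$ is the length of $I$. $\dim_{\mathrm B}$ is box-counting dimension (it exists for $F$). $\dim_{\mathrm A}$ is Assouad dimension: $\dim_{\mathrm A}E=\inf\{u:\exists C>0\ \forall\,0<r<R\ \forall x\in E,\ N_r(B(x,R)\cap E)\le C(R/r)^u\}$, where $N_r(\cdot)$ is the smallest number of open sets of diameter at most $r$ needed to cover the set. *)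

theory Defs
  imports "HOL-Analysis.Analysis" "HOL-Probability.Probability"
begin

definition S1 :: "real \<Rightarrow> real \<Rightarrow> real \<times> real \<Rightarrow> real \<times> real" where
  "S1 \<alpha> \<beta> = (\<lambda>(x, y). (\<beta> * x, \<alpha> * y))"

definition S2 :: "real \<Rightarrow> real \<Rightarrow> real \<times> real \<Rightarrow> real \<times> real" where
  "S2 \<alpha> \<beta> = (\<lambda>(x, y). (\<beta> * x + 1 - \<beta>, \<alpha> * y + 1 - \<alpha>))"

(* For 0 < \<alpha>, \<beta> < 1 both maps are contractions of the plane preserving the unit
   square, so the attractor is unique among all non-empty compact subsets of the plane
   and is contained in the square. *)
definition attractor :: "real \<Rightarrow> real \<Rightarrow> (real \<times> real) set" where
  "attractor \<alpha> \<beta> =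
     (THE F. F \<noteq> {} \<and> compact F \<and> F = S1 \<alpha> \<beta> ` F \<union> S2 \<alpha> \<beta> ` F)"

definition f1 :: "real \<Rightarrow> real \<Rightarrow> real" where
  "f1 \<beta> x = \<beta> * x"

definition f2 :: "real \<Rightarrow> real \<Rightarrow> real" where
  "f2 \<beta> x = \<beta> * x + 1 - \<beta>"

(* A measure on [0,1] is represented as a Borel measure on the real line giving full mass
   to [0,1]. *)
definition bernoulli_conv :: "real \<Rightarrow> real measure" where
  "bernoulli_conv \<beta> =
     (THE \<nu>. prob_space \<nu> \<and> sets \<nu> = sets borel \<and> measure \<nu> {0..1} = 1 \<and>
        (\<forall>A\<in>sets borel.
           measure \<nu> A = 1/2 * measure \<nu> (f1 \<beta> -` A) + 1/2 * measure \<nu> (f2 \<beta> -` A)))"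

(* Singletons count as intervals; as 0 powr t = 0, they contribute the condition that the
   measure has no atoms, which holds for bernoulli_conv \<beta>. *)
definition frostman_exponent :: "real \<Rightarrow> real" where
  "frostman_exponent \<beta> =
     Sup {t. \<exists>C>0. \<forall>I. is_interval I \<and> I \<subseteq> {0..1} \<longrightarrow>
               measure (bernoulli_conv \<beta>) I \<le> C * measure lborel I powr t}"

(* Boundedness is explicit because diameter is unspecified on unbounded sets. The
   minimum exists for every bounded set A and every r > 0. *)
definition covering_number :: "real \<Rightarrow> 'a::euclidean_space set \<Rightarrow> nat" where
  "covering_number r A =
     (LEAST k. \<exists>\<U>. finite \<U> \<and> card \<U> = k \<and> A \<subseteq> \<Union>\<U> \<and>
        (\<forall>U\<in>\<U>. open U \<and> bounded U \<and> diameter U \<le> r))"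

(* Meaningful when the limit exists. *)
definition box_dim :: "'a::euclidean_space set \<Rightarrow> real" where
  "box_dim E = Lim (at_right 0) (\<lambda>r. ln (real (covering_number r E)) / (- ln r))"

definition assouad_dim :: "'a::euclidean_space set \<Rightarrow> real" where
  "assouad_dim E =
     Inf {u. \<exists>C>0. \<forall>r R. 0 < r \<and> r < R \<longrightarrow>
            (\<forall>x\<in>E. real (covering_number r (ball x R \<inter> E)) \<le> C * (R / r) powr u)}"

end

theory Submission
  imports Defs
begin

text \<open>
  A ball of radius \<open>\<alpha>\<^sup>m\<close> meets boundedly many cylinders of level \<open>m\<close>, and inside each of them it is the
  affine image of a vertical strip over an interval of length about \<open>(\<alpha>/\<beta>)\<^sup>m\<close>. Covering the strip at
  relative scale \<open>\<alpha>\<^sup>k\<close> amounts to counting the words of length \<open>k\<close> whose horizontal interval meets it,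
  which is \<open>2\<^sup>k\<close> times the Bernoulli convolution of an interval of length about \<open>\<beta>\<^sup>k\<close>. Hence the Assouad
  condition with exponent \<open>1 + ln (2 \<beta>\<^sup>t) / (- ln \<alpha>)\<close> and the Frostman condition with exponent \<open>t\<close> are
  equivalent up to constants.

  For \<open>s(\<beta>) > 1/2\<close>, group the letters of a word in blocks of length \<open>n\<close>: as soon as \<open>\<beta>\<^sup>n \<le> 1/2\<close>, the first
  letters of the blocks give separated points, whence \<open>s(\<beta>) \<ge> ln 2 / (- n ln \<beta>)\<close>, and for the least such
  \<open>n\<close> this exceeds \<open>1/2\<close>. If \<open>\<beta>\<^sup>n\<close> is only close to \<open>1/2\<close>, the separation still holds for words of a given
  length, and submultiplicativity gives \<open>s(\<beta>) \<rightarrow> 1\<close> as \<open>\<beta>\<close> tends to \<open>2\<close> to the power \<open>- 1/n\<close>.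
\<close>

section \<open>Words and their positions\<close>

text \<open>The two coordinates play opposite roles. Horizontally the cylinders overlap, since
  \<beta> > 1/2, and different words may occupy nearly the same interval. Vertically \<alpha> \<le>
  1/2 keeps words of length k at distance \<alpha>^k, so only boundedly many cylinders stacked over
  one interval can be covered together. The covering count of a strip therefore sees words with
  multiplicity, and that is what the Bernoulli convolution measures. The box dimension sees only the
  total of 2^k words, which corresponds to t = 1, while the Assouad dimension sees the heaviest
  strips; for fixed parameters the gap is thus a multiple of 1 - s(\<beta>). Grouping letters costs
  a factor 4 n + 1 for each run of m blocks. This factor does not depend on m, so its share in the
  exponent vanishes as m grows. Near a parameter with \<beta>^n = 1/2 one fixed large m suffices,
  and for fixed m a small overlap of the blocks (\<beta>^n slightly above 1/2) still leaves the
  positions separated.\<close>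

text \<open>
  The value \<open>pos c w\<close> is the image of \<open>0\<close> under the composition, coded by \<open>w\<close> with the leftmost
  letter outermost, of the maps \<open>x \<mapsto> c x\<close> (\<open>False\<close>) and \<open>x \<mapsto> c x + 1 - c\<close> (\<open>True\<close>).
\<close>
fun pos :: "real \<Rightarrow> bool list \<Rightarrow> real" where
  "pos c [] = 0"
| "pos c (b # w) = of_bool b * (1 - c) + c * pos c w"

definition words :: "nat \<Rightarrow> bool list set" where
  "words n = {w. length w = n}"

lemma length_words: "w \<in> words n \<Longrightarrow> length w = n"
  by (simp add: words_def)

lemma words_0: "words 0 = {[]}"
  by (auto simp: words_def)

lemma words_Suc: "words (Suc n) = Cons True ` words n \<union> Cons False ` words n"
  by (auto simp: words_def length_Suc_conv image_iff)

lemma finite_words [simp]: "finite (words n)"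
  by (induction n) (auto simp: words_0 words_Suc)

lemma sum_words_Suc:
  "(\<Sum>w\<in>words (Suc n). h w) = (\<Sum>w\<in>words n. h (True # w)) + (\<Sum>w\<in>words n. h (False # w))"
  unfolding words_Suc
  by (subst sum.union_disjoint) (auto simp: sum.reindex inj_on_def)

lemma card_words [simp]: "card (words n) = 2 ^ n"
proof -
  have "words n = {w. set w \<subseteq> (UNIV :: bool set) \<and> length w = n}"
    by (auto simp: words_def)
  then show ?thesis
    using card_lists_length_eq[of "UNIV :: bool set" n] by simp
qed

lemma pos_append: "pos c (v @ w) = pos c v + c ^ length v * pos c w"
  by (induction v) (auto simp: algebra_simps)

lemma pos_replicate_False: "pos c (replicate m False) = 0"
  by (induction m) auto

lemma pos_bounds:
  assumes "0 \<le> c" "c \<le> 1"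
  shows "0 \<le> pos c w" "pos c w \<le> 1 - c ^ length w"
proof -
  have "0 \<le> pos c w \<and> pos c w \<le> 1 - c ^ length w"
  proof (induction w)
    case (Cons b w)
    then have "c * pos c w \<le> c * (1 - c ^ length w)"
      using assms by (intro mult_left_mono) auto
    moreover have "0 \<le> of_bool b * (1 - c)" "of_bool b * (1 - c) \<le> 1 - c" "0 \<le> c * pos c w"
      using Cons assms by auto
    ultimately have "0 \<le> of_bool b * (1 - c) + c * pos c w"
      "of_bool b * (1 - c) + c * pos c w \<le> 1 - c + c * (1 - c ^ length w)"
      by linarith+
    then show ?case
      by (simp add: algebra_simps)
  qed auto
  then show "0 \<le> pos c w" "pos c w \<le> 1 - c ^ length w"
    by auto
qed

text \<open>At the first letter where the words differ, with l letters remaining, the positions are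
  at least \<open>1 - c - c * (1 - c ^ l)\<close> apart; this equals \<open>c ^ Suc l\<close> minus
  the overlap \<open>2 * c - 1\<close>. Common letters before it only scale by \<open>c\<close>. The
  parameter \<open>e\<close> measures the tolerated overlap relative to the length of the words:
  \<open>e = 0\<close> is the disjoint case, and \<open>e = 1/2\<close> admits \<open>c\<close>
  slightly above 1/2.\<close>

lemma pos_separation_aux:
  assumes "0 \<le> c" "c \<le> 1" "length v = length w" "v \<noteq> w" "2 * c - 1 \<le> e * c ^ length w" "0 \<le> e"
  shows "(1 - e) * c ^ length w \<le> \<bar>pos c v - pos c w\<bar>"
  using assms(3-5)
proof (induction v w rule: list_induct2)
  case (Cons a v b w)
  have cw: "c * c ^ length w \<le> c ^ length w"
    using assms by (simp add: mult_left_le_one_le)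
  show ?case
  proof (cases "a = b")
    case True
    have "e * (c * c ^ length w) \<le> e * c ^ length w"
      using cw assms by (intro mult_left_mono) auto
    then have "(1 - e) * c ^ length w \<le> \<bar>pos c v - pos c w\<bar>"
      using Cons True by auto
    then have "c * ((1 - e) * c ^ length w) \<le> c * \<bar>pos c v - pos c w\<bar>"
      using assms by (intro mult_left_mono) auto
    moreover have "\<bar>pos c (a # v) - pos c (b # w)\<bar> = c * \<bar>pos c v - pos c w\<bar>"
      using True assms by (simp add: abs_mult flip: right_diff_distrib)
    ultimately show ?thesis
      by (simp add: algebra_simps)
  next
    case False
    have bd: "0 \<le> c * pos c u \<and> c * pos c u \<le> c * (1 - c ^ length w)" if "length u = length w" for u
      using pos_bounds[of c u] assms that by (auto intro!: mult_left_mono)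
    have "\<bar>pos c (a # v) - pos c (b # w)\<bar> \<ge> 1 - c - c * (1 - c ^ length w)"
      using False bd[of v] bd[of w] Cons.hyps by (cases a; cases b) auto
    then show ?thesis
      using Cons.prems by (auto simp: algebra_simps)
  qed
qed auto

lemma pos_separation:
  assumes "0 \<le> c" "c \<le> 1/2" "v \<in> words n" "w \<in> words n" "v \<noteq> w"
  shows "c ^ n \<le> \<bar>pos c v - pos c w\<bar>"
  using pos_separation_aux[of c v w 0] assms by (auto simp: words_def)

lemma pos_separation_half:
  assumes "0 \<le> c" "c \<le> 1" "v \<in> words n" "w \<in> words n" "v \<noteq> w" "2 * c - 1 \<le> c ^ n / 2"
  shows "c ^ n / 2 \<le> \<bar>pos c v - pos c w\<bar>"
  using pos_separation_aux[of c v w "1/2"] assms by (auto simp: words_def)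

text \<open>Cut the window into cells of length \<open>d\<close>: separated values lie in different
  cells, so the cell index is injective on \<open>W\<close>.\<close>

lemma card_separated_le:
  fixes y :: "'a \<Rightarrow> real"
  assumes "0 < d" "0 \<le> D"
    and "\<And>v. v \<in> W \<Longrightarrow> y v \<in> {a..a + D}"
    and sep: "\<And>v w. v \<in> W \<Longrightarrow> w \<in> W \<Longrightarrow> v \<noteq> w \<Longrightarrow> d \<le> \<bar>y v - y w\<bar>"
  shows "real (card W) \<le> D / d + 1"
proof -
  define h where "h v = nat \<lfloor>(y v - a) / d\<rfloor>" for v
  have inj: "inj_on h W"
  proof (rule inj_onI, rule ccontr)
    fix v w assume vw: "v \<in> W" "w \<in> W" "h v = h w" "v \<noteq> w"
    have "0 \<le> (y v - a) / d" "0 \<le> (y w - a) / d"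
      using assms vw by (auto intro!: divide_nonneg_pos)
    then have "\<lfloor>(y v - a) / d\<rfloor> = \<lfloor>(y w - a) / d\<rfloor>"
      using vw(3) unfolding h_def by (simp add: eq_nat_nat_iff)
    then have "\<bar>(y v - a) / d - (y w - a) / d\<bar> < 1"
      by linarith
    moreover have "(y v - a) / d - (y w - a) / d = (y v - y w) / d"
      by (simp add: diff_divide_distrib)
    ultimately have "\<bar>y v - y w\<bar> < d"
      using assms(1) by (simp add: abs_divide)
    with sep[OF vw(1,2,4)] show False by simp
  qed
  have "h ` W \<subseteq> {..nat \<lfloor>D / d\<rfloor>}"
    using assms by (auto simp: h_def intro!: nat_mono floor_mono divide_right_mono) (smt (verit))
  then have "card W \<le> card {..nat \<lfloor>D / d\<rfloor>}"
    by (intro card_inj_on_le[OF inj]) auto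
  moreover have "real (nat \<lfloor>D / d\<rfloor>) \<le> D / d"
    using assms by (intro of_nat_floor) auto
  ultimately show ?thesis by simp
qed

text \<open>
  Splitting a word into blocks of length \<open>Suc n\<close> and collecting the first letters of the blocks
  expresses \<open>pos c\<close> as a multiple of \<open>pos (c ^ Suc n)\<close> plus a term that depends on the other
  letters only. This replaces the factorisation of the Bernoulli convolution as a convolution.
\<close>
fun interleave :: "bool list \<Rightarrow> bool list list \<Rightarrow> bool list" where
  "interleave (b # v) (u # us) = b # u @ interleave v us"
| "interleave _ _ = []"

lemma words_interleave:
  assumes "w \<in> words (Suc n * m)"
  shows "\<exists>v\<in>words m. \<exists>us\<in>{us. set us \<subseteq> words n \<and> length us = m}. w = interleave v us"
  using assms
proof (induction m arbitrary: w)
  case 0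
  then show ?case by (auto simp: words_def)
next
  case (Suc m)
  then obtain b w' where w: "w = b # w'" "length w' = n + Suc n * m"
    by (cases w) (auto simp: words_def)
  have "drop n w' \<in> words (Suc n * m)"
    using w by (auto simp: words_def)
  then obtain v us where "v \<in> words m" "set us \<subseteq> words n" "length us = m"
    "drop n w' = interleave v us"
    using Suc.IH by blast
  then show ?case
    using w append_take_drop_id[of n w']
    by (intro bexI[of _ "b # v"] bexI[of _ "take n w' # us"]) (auto simp: words_def)
qed

text \<open>A first letter of a block has weight \<open>1 - c\<close> in \<open>pos c\<close> but
  \<open>1 - c ^ Suc n\<close> in \<open>pos (c ^ Suc n)\<close>; the quotient is the scaling
  factor. With \<open>us\<close> fixed the position is thus affine in \<open>v\<close>, so
  separation for the ratio \<open>c ^ Suc n\<close> carries over.\<close>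

lemma pos_interleave:
  assumes "length v = length us" "set us \<subseteq> words n" "c ^ Suc n \<noteq> 1"
  shows "pos c (interleave v us) = (1 - c) / (1 - c ^ Suc n) * pos (c ^ Suc n) v
           + pos c (interleave (replicate (length us) False) us)"
  using assms(1,2)
proof (induction v us rule: list_induct2)
  case (Cons b v u us)
  have "length u = n"
    using Cons.prems by (auto simp: words_def)
  have *: "of_bool b * (1 - c) = (1 - c) / (1 - c ^ Suc n) * (of_bool b * (1 - c ^ Suc n))"
    using assms(3) by (simp del: power_Suc)
  have IH: "pos c (interleave v us) = (1 - c) / (1 - c ^ Suc n) * pos (c ^ Suc n) v
           + pos c (interleave (replicate (length us) False) us)"
    using Cons by auto
  show ?case
    using \<open>length u = n\<close> by (simp add: IH pos_append * distrib_left del: power_Suc) (simp add: algebra_simps)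
qed auto

text \<open>Fix all letters except the first ones of the blocks. The remaining \<open>m\<close> free
  letters give positions at least \<open>q * g ^ m / 2\<close> apart, so a window of length
  \<open>2 * g ^ m\<close> holds at most \<open>4 / q + 1\<close> of them. The fixed letters can be
  chosen in \<open>2 ^ ((n - 1) * m)\<close> ways.\<close>

lemma card_pos_window_le:
  assumes "0 < c" "c < 1" "1 \<le> n" "2 * c ^ n - 1 \<le> c ^ (n * m) / 2"
  shows "real (card {w \<in> words (n * m). pos c w \<in> {a..a + 2 * c ^ (n * m)}})
           \<le> (4 * n + 1) * 2 ^ ((n - 1) * m)"
proof -
  define g where "g = c ^ n"
  obtain k where k: "n = Suc k"
    using assms(3) by (cases n) auto
  have g: "0 < g" "g < 1"
    using assms by (auto simp: g_def power_less_one_iff)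
  define q where "q = (1 - c) / (1 - g)"
  have q: "0 < q" using g assms by (simp add: q_def)
  \<comment> \<open>The geometric sum has \<open>n\<close> terms, each at most 1, hence
    \<open>q \<ge> 1 / n\<close>; this is the origin of the \<open>n\<close> in
    \<open>4 * n + 1\<close>.\<close>
  have "1 - g = (1 - c) * (\<Sum>i<n. c ^ i)"
    unfolding g_def using one_diff_power_eq by blast
  moreover have "(\<Sum>i<n. c ^ i) \<le> (\<Sum>i<n. 1)"
    using assms by (intro sum_mono) (auto simp: power_le_one)
  ultimately have "1 - g \<le> (1 - c) * n"
    using assms by (auto intro!: mult_left_mono)
  then have nq: "1 \<le> n * q"
    using g by (simp add: q_def field_simps)
  define U where "U = {us. set us \<subseteq> words k \<and> length us = m}"
  have cardU: "card U = 2 ^ (k * m)" and finU: "finite U"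
    unfolding U_def by (auto simp: card_lists_length_eq power_mult finite_lists_length_eq)
  define V where "V us = {v \<in> words m. pos c (interleave v us) \<in> {a..a + 2 * g ^ m}}" for us
  have cardV: "card (V us) \<le> 4 * n + 1" if us: "us \<in> U" for us
  proof -
    define b where "b = pos c (interleave (replicate m False) us)"
    have p: "pos c (interleave v us) = q * pos g v + b" if "v \<in> words m" for v
      using pos_interleave[of v us k c] us that g
      by (auto simp: U_def words_def q_def b_def g_def k simp del: power_Suc)
    have "real (card (V us)) \<le> (2 * g ^ m) / (q * (g ^ m / 2)) + 1"
    proof (rule card_separated_le[where y = "\<lambda>v. pos c (interleave v us)" and a = a])
      fix v w assume vw: "v \<in> V us" "w \<in> V us" "v \<noteq> w"
      have "g ^ m / 2 \<le> \<bar>pos g v - pos g w\<bar>"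
        using vw g assms(4) by (intro pos_separation_half) (auto simp: V_def g_def power_mult)
      then have "q * (g ^ m / 2) \<le> q * \<bar>pos g v - pos g w\<bar>"
        using q by (intro mult_left_mono) auto
      also have "\<dots> = \<bar>pos c (interleave v us) - pos c (interleave w us)\<bar>"
        using vw p q by (auto simp: V_def abs_mult simp flip: right_diff_distrib)
      finally show "q * (g ^ m / 2) \<le> \<bar>pos c (interleave v us) - pos c (interleave w us)\<bar>" .
    qed (use q g in \<open>auto simp: V_def\<close>)
    also have "(2 * g ^ m) / (q * (g ^ m / 2)) = 4 / q"
      using g q by (simp add: field_simps)
    also have "4 / q \<le> 4 * n"
      using nq q by (simp add: field_simps)
    finally show ?thesis by linarith
  qed
  have "{w \<in> words (n * m). pos c w \<in> {a..a + 2 * c ^ (n * m)}} \<subseteq> (\<Union>us\<in>U. (\<lambda>v. interleave v us) ` V us)"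
  proof
    fix w assume w: "w \<in> {w \<in> words (n * m). pos c w \<in> {a..a + 2 * c ^ (n * m)}}"
    then obtain v us where "v \<in> words m" "us \<in> U" "w = interleave v us"
      using words_interleave[of w k m] unfolding U_def k by auto
    with w show "w \<in> (\<Union>us\<in>U. (\<lambda>v. interleave v us) ` V us)"
      by (auto simp: V_def g_def power_mult)
  qed
  moreover have "finite (V us)" for us
    by (auto simp: V_def)
  ultimately have "card {w \<in> words (n * m). pos c w \<in> {a..a + 2 * c ^ (n * m)}}
      \<le> card (\<Union>us\<in>U. (\<lambda>v. interleave v us) ` V us)"
    using finU by (intro card_mono) auto
  also have "\<dots> \<le> (\<Sum>us\<in>U. card ((\<lambda>v. interleave v us) ` V us))"
    using finU by (rule card_UN_le)
  also have "\<dots> \<le> (\<Sum>us\<in>U. 4 * n + 1)"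
    using cardV \<open>\<And>us. finite (V us)\<close> by (intro sum_mono) (meson card_image_le le_trans)
  also have "\<dots> = (4 * n + 1) * 2 ^ ((n - 1) * m)"
    by (simp add: cardU k)
  finally show ?thesis
    using of_nat_mono by fastforce
qed

section \<open>Self-similar measures\<close>

definition self_similar_measure :: "real \<Rightarrow> real measure \<Rightarrow> bool" where
  "self_similar_measure \<beta> \<nu> \<longleftrightarrow>
     prob_space \<nu> \<and> sets \<nu> = sets borel \<and> measure \<nu> {0..1} = 1 \<and>
     (\<forall>A\<in>sets borel.
        measure \<nu> A = 1/2 * measure \<nu> (f1 \<beta> -` A) + 1/2 * measure \<nu> (f2 \<beta> -` A))"

lemma bernoulli_conv_eq_The: "bernoulli_conv \<beta> = (THE \<nu>. self_similar_measure \<beta> \<nu>)"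
  by (simp add: bernoulli_conv_def self_similar_measure_def)

text \<open>Stated for any solution of the self-similarity equation, since uniqueness compares two
  of them; only afterwards can \<open>bernoulli_conv\<close> be shown to be an instance.\<close>

locale self_similar_prob =
  fixes \<beta> :: real and \<nu> :: "real measure"
  assumes \<beta>: "0 < \<beta>" "\<beta> < 1"
    and self_similar: "self_similar_measure \<beta> \<nu>"
begin

sublocale prob_space \<nu>
  using self_similar by (simp add: self_similar_measure_def)

lemma sets_\<nu> [simp]: "sets \<nu> = sets borel"
  using self_similar by (simp add: self_similar_measure_def)

lemma space_\<nu> [simp]: "space \<nu> = UNIV"
  using sets_eq_imp_space_eq[OF sets_\<nu>] by simp

lemma measure_unit [simp]: "measure \<nu> {0..1} = 1"
  using self_similar by (simp add: self_similar_measure_def)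

lemma measure_eq_0: "A \<in> sets borel \<Longrightarrow> A \<inter> {0..1} = {} \<Longrightarrow> measure \<nu> A = 0"
  using finite_measure_mono[of A "UNIV - {0..1}"] prob_compl[of "{0..1}"]
  by (auto simp: measure_le_0_iff)

lemma measure_eq_1: "A \<in> sets borel \<Longrightarrow> {0..1} \<subseteq> A \<Longrightarrow> measure \<nu> A = 1"
  using finite_measure_mono[of "{0..1}" A] prob_le_1[of A] by auto

lemma measure_le_unit: "A \<in> sets borel \<Longrightarrow> B \<in> sets borel \<Longrightarrow> A \<inter> {0..1} \<subseteq> B \<Longrightarrow> measure \<nu> A \<le> measure \<nu> B"
  using finite_measure_mono[of A "B \<union> (UNIV - {0..1})"] measure_eq_0[of "UNIV - {0..1}"]
    measure_Un_le[of B \<nu> "UNIV - {0..1}"]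
  by (simp add: disjoint_iff) (smt (verit) Diff_iff UnCI UNIV_I disjoint_iff IntI in_mono subsetI)

lemma vimage_borel: "A \<in> sets borel \<Longrightarrow> (\<lambda>x. p + c * x) -` A \<in> sets borel" for p c :: real
  by (rule measurable_sets_borel) auto

lemma measure_words:
  "A \<in> sets borel \<Longrightarrow>
     measure \<nu> A = (\<Sum>w\<in>words N. measure \<nu> ((\<lambda>x. pos \<beta> w + \<beta> ^ N * x) -` A)) / 2 ^ N"
proof (induction N arbitrary: A)
  case 0
  then show ?case by (simp add: words_0)
next
  case (Suc N)
  have "f1 \<beta> = (\<lambda>x. 0 + \<beta> * x)" "f2 \<beta> = (\<lambda>x. 1 - \<beta> + \<beta> * x)"
    by (auto simp: f1_def f2_def)
  then have f: "f1 \<beta> -` A \<in> sets borel" "f2 \<beta> -` A \<in> sets borel"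
    using vimage_borel[OF Suc.prems] by (simp_all only:)
  have "measure \<nu> A = 1/2 * measure \<nu> (f1 \<beta> -` A) + 1/2 * measure \<nu> (f2 \<beta> -` A)"
    using self_similar Suc.prems by (simp add: self_similar_measure_def)
  also have "\<dots> = (\<Sum>w\<in>words (Suc N). measure \<nu> ((\<lambda>x. pos \<beta> w + \<beta> ^ Suc N * x) -` A)) / 2 ^ Suc N"
    unfolding sum_words_Suc Suc.IH[OF f(1)] Suc.IH[OF f(2)]
    by (simp add: f1_def f2_def vimage_def algebra_simps add_divide_distrib)
  finally show ?case .
qed

text \<open>The measure is the average of its 2^N scaled copies, one for each word. A copy whose
  interval misses \<open>A\<close> contributes nothing, any other at most 1. Together with the
  reverse estimate in \<open>card_words_le_measure\<close> this translates between masses and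
  numbers of words.\<close>

lemma measure_le_card_words:
  assumes "A \<in> sets borel"
  shows "measure \<nu> A \<le> card {w \<in> words N. A \<inter> {pos \<beta> w..pos \<beta> w + \<beta> ^ N} \<noteq> {}} / 2 ^ N"
proof -
  let ?T = "\<lambda>w x. pos \<beta> w + \<beta> ^ N * x"
  have "measure \<nu> (?T w -` A) \<le> of_bool (A \<inter> {pos \<beta> w..pos \<beta> w + \<beta> ^ N} \<noteq> {})" for w
  proof (cases "A \<inter> {pos \<beta> w..pos \<beta> w + \<beta> ^ N} = {}")
    case True
    have "?T w x \<in> {pos \<beta> w..pos \<beta> w + \<beta> ^ N}" if "x \<in> {0..1}" for x
      using that \<beta> by (auto simp: mult_left_le)
    then have "measure \<nu> (?T w -` A) = 0"
      using True assms by (intro measure_eq_0 vimage_borel) blast+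
    then show ?thesis by simp
  qed auto
  then have "(\<Sum>w\<in>words N. measure \<nu> (?T w -` A))
      \<le> (\<Sum>w\<in>words N. of_bool (A \<inter> {pos \<beta> w..pos \<beta> w + \<beta> ^ N} \<noteq> {}))"
    by (intro sum_mono)
  also have "\<dots> = real (card {w \<in> words N. A \<inter> {pos \<beta> w..pos \<beta> w + \<beta> ^ N} \<noteq> {}})"
    by (simp add: sum.If_cases of_bool_def Int_def)
  finally show ?thesis
    using measure_words[OF assms, of N] by (simp add: divide_right_mono)
qed

text \<open>A copy whose interval lies in \<open>A\<close> contributes its whole mass 1 to the
  average.\<close>

lemma card_words_le_measure:
  assumes "A \<in> sets borel" "W \<subseteq> words N"
    and "\<And>w. w \<in> W \<Longrightarrow> {pos \<beta> w..pos \<beta> w + \<beta> ^ N} \<inter> {0..1} \<subseteq> A"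
  shows "card W \<le> 2 ^ N * measure \<nu> A"
proof -
  let ?T = "\<lambda>w x. pos \<beta> w + \<beta> ^ N * x"
  have "measure \<nu> (?T w -` A) = 1" if "w \<in> W" for w
  proof (rule measure_eq_1)
    have len: "length w = N"
      using that assms by (auto simp: words_def)
    show "{0..1} \<subseteq> ?T w -` A"
    proof (rule subsetI)
      fix x :: real assume x: "x \<in> {0..1}"
      then have "?T w x \<in> {pos \<beta> w..pos \<beta> w + \<beta> ^ N}"
        using \<beta> by (auto simp: mult_left_le)
      moreover from this have "?T w x \<in> {0..1}"
        using pos_bounds[of \<beta> w] \<beta> unfolding len atLeastAtMost_iff by linarith
      ultimately show "x \<in> ?T w -` A"
        using assms(3)[OF that] by blast
    qed
  qed (use assms in \<open>auto intro: vimage_borel\<close>)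
  then have "real (card W) = (\<Sum>w\<in>W. measure \<nu> (?T w -` A))"
    by simp
  also have "\<dots> \<le> (\<Sum>w\<in>words N. measure \<nu> (?T w -` A))"
    using assms by (intro sum_mono2) auto
  finally show ?thesis
    using measure_words[OF assms(1), of N] by simp
qed

text \<open>This is the submultiplicative step. A copy of level \<open>n * m\<close> sees the window
  pulled back to length \<open>l\<close>, hence with mass at most \<open>B\<close>, and only the
  fraction \<open>(4 * n + 1) / 2 ^ m\<close> of all copies can see it at all.\<close>

lemma measure_window_le:
  assumes "1 \<le> n" "2 * \<beta> ^ n - 1 \<le> \<beta> ^ (n * m) / 2" "0 \<le> l" "l \<le> 1"
    and B: "\<And>a. measure \<nu> {a..a + l} \<le> B"
  shows "measure \<nu> {a..a + \<beta> ^ (n * m) * l} \<le> (4 * n + 1) / 2 ^ m * B"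
proof -
  define N where "N = n * m"
  \<comment> \<open>Since \<open>l \<le> 1\<close> the window is no longer than
    \<open>\<beta> ^ N\<close>, so an interval that meets it must start within
    \<open>\<beta> ^ N\<close> of \<open>a\<close> on either side.\<close>
  define W where "W = {w \<in> words N. pos \<beta> w \<in> {a - \<beta> ^ N..a - \<beta> ^ N + 2 * \<beta> ^ N}}"
  let ?T = "\<lambda>w x. pos \<beta> w + \<beta> ^ N * x"
  have p: "0 < \<beta> ^ N" using \<beta> by simp
  have "0 \<le> B" using B[of 0] measure_nonneg order_trans by blast
  have T: "measure \<nu> (?T w -` {a..a + \<beta> ^ N * l}) \<le> (if w \<in> W then B else 0)" if "w \<in> words N" for w
  proof -
    have eq: "?T w -` {a..a + \<beta> ^ N * l} = {(a - pos \<beta> w) / \<beta> ^ N..(a - pos \<beta> w) / \<beta> ^ N + l}"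
    proof (intro set_eqI)
      fix x
      have "x \<le> (a - pos \<beta> w) / \<beta> ^ N + l \<longleftrightarrow> x - l \<le> (a - pos \<beta> w) / \<beta> ^ N"
        by linarith
      also have "\<dots> \<longleftrightarrow> pos \<beta> w + \<beta> ^ N * x \<le> a + \<beta> ^ N * l"
        using p by (subst pos_le_divide_eq) (auto simp: algebra_simps)
      finally show "x \<in> ?T w -` {a..a + \<beta> ^ N * l} \<longleftrightarrow>
          x \<in> {(a - pos \<beta> w) / \<beta> ^ N..(a - pos \<beta> w) / \<beta> ^ N + l}"
        using p by (auto simp: pos_divide_le_eq algebra_simps)
    qed
    show ?thesis
    proof (cases "w \<in> W")
      case True
      then show ?thesis using B by (simp add: eq)
    next
      case False
      have "measure \<nu> (?T w -` {a..a + \<beta> ^ N * l}) = 0"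
      proof (intro measure_eq_0 vimage_borel)
        have "pos \<beta> w < a - \<beta> ^ N \<or> pos \<beta> w > a + \<beta> ^ N"
          using False that by (auto simp: W_def)
        moreover have "\<beta> ^ N * l \<le> \<beta> ^ N"
          using p assms by (simp add: mult_left_le)
        moreover have "0 \<le> \<beta> ^ N * x \<and> \<beta> ^ N * x \<le> \<beta> ^ N" if "x \<in> {0..1}" for x
          using that p by (auto simp: mult_left_le)
        ultimately show "?T w -` {a..a + \<beta> ^ N * l} \<inter> {0..1} = {}"
          by fastforce
      qed auto
      then show ?thesis using False by simp
    qed
  qed
  have "(\<Sum>w\<in>words N. measure \<nu> (?T w -` {a..a + \<beta> ^ N * l})) \<le> (\<Sum>w\<in>words N. if w \<in> W then B else 0)"
    using T by (intro sum_mono) auto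
  also have "\<dots> = card W * B"
    by (simp add: sum.If_cases W_def Int_def)
  also have "\<dots> \<le> (4 * n + 1) * 2 ^ ((n - 1) * m) * B"
    using card_pos_window_le[OF \<beta> assms(1,2), of "a - \<beta> ^ N"] \<open>0 \<le> B\<close>
    unfolding W_def N_def by (intro mult_right_mono) auto
  finally have "measure \<nu> {a..a + \<beta> ^ N * l} \<le> ((4 * n + 1) * 2 ^ ((n - 1) * m) * B) / 2 ^ N"
    using measure_words[of "{a..a + \<beta> ^ N * l}" N] by (simp add: divide_right_mono)
  also have "n * m = (n - 1) * m + m"
    using assms(1) by (cases n) auto
  then have "((4 * n + 1) * 2 ^ ((n - 1) * m) * B) / 2 ^ N = (4 * n + 1) / 2 ^ m * B"
    by (simp add: N_def power_add del: One_nat_def)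
  finally show ?thesis
    unfolding N_def by (simp only: of_nat_add of_nat_mult of_nat_numeral of_nat_1)
qed

lemma measure_window_power_le:
  assumes "1 \<le> n" "2 * \<beta> ^ n - 1 \<le> \<beta> ^ (n * m) / 2"
  shows "measure \<nu> {a..a + (\<beta> ^ (n * m)) ^ q} \<le> ((4 * n + 1) / 2 ^ m) ^ q"
proof (induction q arbitrary: a)
  case (Suc q)
  show ?case
    using measure_window_le[OF assms _ _ Suc.IH, of a] \<beta> by (simp add: power_le_one)
qed auto

end

section \<open>Uniqueness and existence of the Bernoulli convolution\<close>

lemma exists_power_le_half: "0 < c \<Longrightarrow> c < 1 \<Longrightarrow> \<exists>n\<ge>1. c ^ n \<le> (1/2 :: real)"
proof -
  assume "0 < c" "c < 1"
  then obtain n where "c ^ n < 1/2"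
    using real_arch_pow_inv[of "1/2" c] by auto
  then show ?thesis
    by (intro exI[of _ n]) (cases n; auto)
qed

text \<open>Two solutions give the same mass to \<open>{..a}\<close> in every copy that lies on one
  side of \<open>a\<close>, so their distribution functions at \<open>a\<close> differ at most by
  the proportion of words whose interval can contain \<open>a\<close>. The set \<open>W\<close> is
  taken wider, to fit \<open>card_pos_window_le\<close>; its proportion is at most
  \<open>(4 * n + 1) / 2 ^ m\<close>, which tends to 0.\<close>

lemma self_similar_measure_unique:
  assumes "0 < \<beta>" "\<beta> < 1" "self_similar_measure \<beta> \<mu>" "self_similar_measure \<beta> \<nu>"
  shows "\<mu> = \<nu>"
proof (rule cdf_unique)
  interpret M: self_similar_prob \<beta> \<mu> using assms by unfold_locales
  interpret N: self_similar_prob \<beta> \<nu> using assms by unfold_locales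
  show "real_distribution \<mu>" "real_distribution \<nu>"
    by (auto simp: real_distribution_def real_distribution_axioms_def M.prob_space_axioms N.prob_space_axioms)
  obtain n where n: "1 \<le> n" "\<beta> ^ n \<le> 1/2"
    using exists_power_le_half assms by blast
  show "cdf \<mu> = cdf \<nu>"
  proof
    fix a
    have "\<bar>cdf \<mu> a - cdf \<nu> a\<bar> \<le> (4 * n + 1) * (1/2) ^ m" for m
    proof -
      define N where "N = n * m"
      define W where "W = {w \<in> words N. pos \<beta> w \<in> {a - \<beta> ^ N..a - \<beta> ^ N + 2 * \<beta> ^ N}}"
      let ?T = "\<lambda>w x. pos \<beta> w + \<beta> ^ N * x"
      have p: "0 < \<beta> ^ N" using assms by simp
      have T: "\<bar>measure \<mu> (?T w -` {..a}) - measure \<nu> (?T w -` {..a})\<bar> \<le> (if w \<in> W then 1 else 0)"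
        if w: "w \<in> words N" for w
      proof (cases "w \<in> W")
        case True
        then show ?thesis
          using M.prob_le_1[of "?T w -` {..a}"] N.prob_le_1[of "?T w -` {..a}"]
            measure_nonneg[of \<mu> "?T w -` {..a}"] measure_nonneg[of \<nu> "?T w -` {..a}"]
          by (simp only: if_True)
      next
        case False
        have bx: "0 \<le> \<beta> ^ N * x \<and> \<beta> ^ N * x \<le> \<beta> ^ N" if "x \<in> {0..1}" for x
          using that p by (auto simp: mult_left_le)
        have meas: "?T w -` {..a} \<in> sets borel"
          by (rule M.vimage_borel) auto
        consider "pos \<beta> w < a - \<beta> ^ N" | "pos \<beta> w > a"
          using False w p by (fastforce simp: W_def)
        then show ?thesis
        proof cases
          case 1
          then have "{0..1} \<subseteq> ?T w -` {..a}" using bx by fastforce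
          then show ?thesis using M.measure_eq_1 N.measure_eq_1 meas by simp
        next
          case 2
          then have "?T w -` {..a} \<inter> {0..1} = {}" using bx by fastforce
          then show ?thesis using M.measure_eq_0 N.measure_eq_0 meas by simp
        qed
      qed
      have "cdf \<mu> a - cdf \<nu> a
          = (\<Sum>w\<in>words N. measure \<mu> (?T w -` {..a}) - measure \<nu> (?T w -` {..a})) / 2 ^ N"
        unfolding cdf_def
        by (subst M.measure_words[of _ N], simp, subst N.measure_words[of _ N], simp)
          (simp add: sum_subtractf diff_divide_distrib)
      then have "\<bar>cdf \<mu> a - cdf \<nu> a\<bar>
          = \<bar>\<Sum>w\<in>words N. measure \<mu> (?T w -` {..a}) - measure \<nu> (?T w -` {..a})\<bar> / 2 ^ N"
        by (simp add: abs_divide)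
      also have "\<dots> \<le> (\<Sum>w\<in>words N. if w \<in> W then 1 else 0) / 2 ^ N"
        using T by (intro divide_right_mono order_trans[OF sum_abs] sum_mono) auto
      also have "\<dots> = card W / 2 ^ N"
        by (simp add: sum.If_cases W_def Int_def)
      also have "\<dots> \<le> (4 * n + 1) * 2 ^ ((n - 1) * m) / 2 ^ N"
      proof -
        have "2 * \<beta> ^ n - 1 \<le> 0" "0 \<le> \<beta> ^ (n * m) / 2"
          using n assms by auto
        then show ?thesis
          using card_pos_window_le[OF assms(1,2) n(1), of m "a - \<beta> ^ N"]
          unfolding W_def N_def by (intro divide_right_mono) auto
      qed
      also have "n * m = (n - 1) * m + m"
        using n(1) by (cases n) auto
      then have "(4 * n + 1) * 2 ^ ((n - 1) * m) / 2 ^ N = (4 * n + 1) * (1/2 :: real) ^ m"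
        by (simp add: N_def power_add power_divide del: One_nat_def of_nat_add)
      finally show ?thesis .
    qed
    moreover have "(\<lambda>m. (4 * n + 1) * (1/2 :: real) ^ m) \<longlonglongrightarrow> 0"
      by (intro tendsto_mult_right_zero LIMSEQ_power_zero) auto
    ultimately have "\<bar>cdf \<mu> a - cdf \<nu> a\<bar> \<le> 0"
      by (meson LIMSEQ_le_const)
    then show "cdf \<mu> a = cdf \<nu> a" by simp
  qed
qed

text \<open>The law of a random geometric series with fair coin tosses as digits solves the
  equation.\<close>

lemma self_similar_measure_exists:
  assumes "0 < \<beta>" "\<beta> < 1"
  shows "\<exists>\<nu>. self_similar_measure \<beta> \<nu>"
proof -
  define P where "P = measure_pmf (pmf_of_set (UNIV :: bool set))"
  define M where "M = stream_space P"
  \<comment> \<open>The factor \<open>1 - \<beta>\<close> normalises the series to [0,1], as the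
    digits are 0 and 1 and the powers of \<open>\<beta>\<close> sum to
    \<open>1 / (1 - \<beta>)\<close>.\<close>
  define X where "X \<omega> = (1 - \<beta>) * (\<Sum>k. of_bool (\<omega> !! k) * \<beta> ^ k)" for \<omega> :: "bool stream"
  define \<nu> where "\<nu> = distr M borel X"
  interpret P: prob_space P unfolding P_def by (rule prob_space_measure_pmf)
  interpret M: prob_space M unfolding M_def by (rule P.prob_space_stream_space)
  have [measurable]: "(\<lambda>\<omega>. of_bool (\<omega> !! k) :: real) \<in> borel_measurable M" for k
  proof -
    have "(\<lambda>\<omega>. \<omega> !! k) \<in> measurable M P"
      unfolding M_def by measurable
    moreover have "(of_bool :: bool \<Rightarrow> real) \<in> borel_measurable P"
      by (simp add: P_def)
    ultimately show ?thesis
      by (rule measurable_compose)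
  qed
  have X [measurable]: "X \<in> borel_measurable M"
    unfolding X_def[abs_def] by measurable
  have sm: "summable (\<lambda>k. of_bool (\<omega> !! k) * \<beta> ^ k)" for \<omega>
    by (rule summable_comparison_test'[where g = "\<lambda>k. \<beta> ^ k"]) (use assms in auto)
  have X_Cons: "X (b ## \<omega>) = of_bool b * (1 - \<beta>) + \<beta> * X \<omega>" for b \<omega>
  proof -
    have "(\<Sum>k. of_bool ((b ## \<omega>) !! k) * \<beta> ^ k)
        = of_bool b + (\<Sum>k. of_bool ((b ## \<omega>) !! Suc k) * \<beta> ^ Suc k)"
      using suminf_split_head[OF sm, of "b ## \<omega>"] by simp
    also have "(\<Sum>k. of_bool ((b ## \<omega>) !! Suc k) * \<beta> ^ Suc k) = \<beta> * (\<Sum>k. of_bool (\<omega> !! k) * \<beta> ^ k)"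
      by (subst suminf_mult[OF sm, symmetric]) (simp add: mult_ac)
    finally show ?thesis by (simp add: X_def algebra_simps)
  qed
  have X01: "X \<omega> \<in> {0..1}" for \<omega>
  proof -
    have "(\<Sum>k. of_bool (\<omega> !! k) * \<beta> ^ k) \<le> (\<Sum>k. \<beta> ^ k)"
      using assms by (intro suminf_le sm) auto
    also have "\<dots> = 1 / (1 - \<beta>)"
      using assms by (intro suminf_geometric) auto
    finally have "X \<omega> \<le> (1 - \<beta>) * (1 / (1 - \<beta>))"
      unfolding X_def using assms by (intro mult_left_mono) auto
    moreover have "0 \<le> (\<Sum>k. of_bool (\<omega> !! k) * \<beta> ^ k)"
      using assms by (intro suminf_nonneg sm) auto
    ultimately show ?thesis
      using assms by (auto simp: X_def)
  qed
  have space_M: "space M = UNIV"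
    by (simp add: M_def space_stream_space P_def streams_UNIV)
  have eq: "measure \<nu> A = 1/2 * measure \<nu> (f1 \<beta> -` A) + 1/2 * measure \<nu> (f2 \<beta> -` A)"
    if A: "A \<in> sets borel" for A
  proof -
    have fA: "f1 \<beta> -` A \<in> sets borel" "f2 \<beta> -` A \<in> sets borel"
      using A by (auto intro!: measurable_sets_borel simp: f1_def[abs_def] f2_def[abs_def])
    \<comment> \<open>Conditioning on the first toss: by \<open>X_Cons\<close> the rest of the
      stream is sent through \<open>f2 \<beta>\<close> or \<open>f1 \<beta>\<close>.\<close>
    have "emeasure M (X -` A) = (\<integral>\<^sup>+ b. emeasure M {\<omega> \<in> space M. b ## \<omega> \<in> X -` A} \<partial>P)"
      unfolding M_def
      by (rule P.emeasure_stream_space) (use measurable_sets[OF X A] in \<open>simp add: space_M flip: M_def\<close>)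
    also have "\<dots> = (\<integral>\<^sup>+ b. emeasure M (if b then X -` (f2 \<beta> -` A) else X -` (f1 \<beta> -` A)) \<partial>P)"
      by (intro nn_integral_cong arg_cong[where f = "emeasure M"])
        (auto simp: X_Cons f1_def f2_def space_M algebra_simps)
    also have "\<dots> = (\<Sum>b\<in>UNIV. emeasure M (if b then X -` (f2 \<beta> -` A) else X -` (f1 \<beta> -` A))) / 2"
      unfolding P_def by (subst nn_integral_pmf_of_set) (auto simp: UNIV_bool)
    also have "\<dots> = (emeasure M (X -` (f1 \<beta> -` A)) + emeasure M (X -` (f2 \<beta> -` A))) / 2"
      by (simp add: UNIV_bool)
    finally have "measure M (X -` A) = (measure M (X -` (f1 \<beta> -` A)) + measure M (X -` (f2 \<beta> -` A))) / 2"
      by (simp add: M.emeasure_eq_measure divide_ennreal flip: ennreal_plus ennreal_numeral)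
    then show ?thesis
      using A fA by (simp add: \<nu>_def measure_distr space_M)
  qed
  have "prob_space \<nu>" unfolding \<nu>_def by (rule M.prob_space_distr) measurable
  moreover have "measure \<nu> {0..1} = 1"
  proof -
    have "X -` {0..1} \<inter> space M = space M" using X01 by auto
    then show ?thesis by (simp add: \<nu>_def measure_distr M.prob_space)
  qed
  ultimately show ?thesis
    using eq by (intro exI[of _ \<nu>]) (auto simp: self_similar_measure_def \<nu>_def)
qed

lemma self_similar_bernoulli_conv:
  assumes "0 < \<beta>" "\<beta> < 1"
  shows "self_similar_prob \<beta> (bernoulli_conv \<beta>)"
proof -
  have "\<exists>!\<nu>. self_similar_measure \<beta> \<nu>"
    using self_similar_measure_exists self_similar_measure_unique assms by blast
  then show ?thesis
    using assms theI'[of "self_similar_measure \<beta>"]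
    by unfold_locales (auto simp: bernoulli_conv_eq_The)
qed

section \<open>The Frostman exponent\<close>

definition frostman_set :: "real \<Rightarrow> real set" where
  "frostman_set \<beta> = {t. \<exists>C>0. \<forall>I. is_interval I \<and> I \<subseteq> {0..1} \<longrightarrow>
               measure (bernoulli_conv \<beta>) I \<le> C * measure lborel I powr t}"

lemma frostman_exponent_eq: "frostman_exponent \<beta> = Sup (frostman_set \<beta>)"
  by (simp add: frostman_exponent_def frostman_set_def)

lemma exists_power_bracket:
  fixes c z :: real
  assumes "0 < c" "c < 1" "0 < z" "z \<le> 1"
  shows "\<exists>n. c ^ Suc n < z \<and> z \<le> c ^ n"
proof -
  obtain k where "c ^ k < z"
    using real_arch_pow_inv assms by blast
  then obtain k where k: "c ^ k < z" "\<forall>i<k. \<not> c ^ i < z"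
    using exists_least_iff[of "\<lambda>k. c ^ k < z"] by blast
  then have "k \<noteq> 0" using assms by (intro notI) auto
  then obtain n where "k = Suc n" using not0_implies_Suc by blast
  with k show ?thesis by (intro exI[of _ n]) auto
qed

text \<open>The closed hull has the same length, so the Frostman condition need only be tested on
  closed intervals.\<close>

lemma interval_unit_bounds:
  fixes I :: "real set"
  assumes "is_interval I" "I \<subseteq> {0..1}" "I \<noteq> {}"
  obtains a b where "0 \<le> a" "a \<le> b" "b \<le> 1" "I \<subseteq> {a..b}" "measure lborel I = b - a"
proof
  have bd: "bdd_below I" "bdd_above I"
    using assms by (meson bdd_below.I bdd_above.I atLeastAtMost_iff subsetD)+
  obtain x where x: "x \<in> I" using assms by blast
  show "0 \<le> Inf I" "Sup I \<le> 1"
    using assms by (auto intro!: cInf_greatest cSup_least)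
  show sub: "I \<subseteq> {Inf I..Sup I}"
    using bd by (auto intro: cInf_lower cSup_upper)
  then show le: "Inf I \<le> Sup I" using x by (meson atLeastAtMost_iff order_trans subsetD)
  have "{Inf I<..<Sup I} \<subseteq> I"
  proof
    fix y assume "y \<in> {Inf I<..<Sup I}"
    then obtain u v where "u \<in> I" "u < y" "v \<in> I" "y < v"
      using cInf_less_iff[OF assms(3) bd(1)] less_cSup_iff[OF assms(3) bd(2)] by auto
    then show "y \<in> I"
      using assms(1) unfolding is_interval_1 by (meson less_imp_le)
  qed
  moreover have "I \<in> sets borel"
    using assms(1) is_real_interval[of I] by auto
  moreover have "emeasure lborel I < \<infinity>"
    using emeasure_mono[OF sub, of lborel] le by (auto simp: less_top intro: le_less_trans)
  ultimately have "measure lborel {Inf I<..<Sup I} \<le> measure lborel I"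
    "measure lborel I \<le> measure lborel {Inf I..Sup I}"
    using sub le by (intro measure_mono_fmeasurable; simp add: fmeasurable_def emeasure_lborel_Icc_eq)+
  then show "measure lborel I = Sup I - Inf I"
    using le by simp
qed

context self_similar_prob
begin

text \<open>Cutting [0,1] into \<open>n\<close> equal pieces gives
  \<open>1 \<le> n * C * (1 / n) powr t\<close>, that is \<open>n powr (t - 1) \<le> C\<close> for
  every \<open>n\<close>.\<close>

lemma frostman_le_1:
  assumes C: "0 < C" "\<And>a b. 0 \<le> a \<Longrightarrow> a < b \<Longrightarrow> b \<le> 1 \<Longrightarrow> measure \<nu> {a..b} \<le> C * (b - a) powr t"
  shows "t \<le> 1"
proof (rule ccontr)
  assume "\<not> t \<le> 1"
  then have t: "t - 1 > 0" by simp
  have bound: "real n powr (t - 1) \<le> C" if n: "n > 0" for n :: nat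
  proof -
    have "1 = measure \<nu> {0..1}" by simp
    also have "\<dots> \<le> measure \<nu> (\<Union>i<n. {real i / n..(real i + 1) / n})"
    proof (rule finite_measure_mono)
      show "{0..1} \<subseteq> (\<Union>i<n. {real i / n..(real i + 1) / n})"
      proof
        fix x :: real assume x: "x \<in> {0..1}"
        show "x \<in> (\<Union>i<n. {real i / n..(real i + 1) / n})"
        proof (cases "x = 1")
          case True
          then show ?thesis
            using n by (intro UN_I[of "n - 1"]) (auto simp: field_simps of_nat_diff)
        next
          case False
          define i where "i = nat \<lfloor>x * n\<rfloor>"
          have i: "real i \<le> x * n" "x * n < i + 1"
            using x by (simp_all add: i_def) linarith
          moreover have "x * n < n" using False x n by simp
          ultimately have "i < n" by linarith
          then show ?thesis
            using i n by (intro UN_I[of i]) (auto simp: field_simps)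
        qed
      qed
    qed auto
    also have "\<dots> \<le> (\<Sum>i<n. measure \<nu> {real i / n..(real i + 1) / n})"
      by (rule finite_measure_subadditive_finite) auto
    also have "\<dots> \<le> (\<Sum>i<n. C * (1 / n) powr t)"
    proof (rule sum_mono)
      fix i assume "i \<in> {..<n}"
      moreover have "(real i + 1) / n - i / n = 1 / n"
        by (simp flip: diff_divide_distrib)
      ultimately show "measure \<nu> {real i / n..(real i + 1) / n} \<le> C * (1 / n) powr t"
        using C(2)[of "real i / n" "(real i + 1) / n"] by (simp add: divide_strict_right_mono)
    qed
    also have "\<dots> = C * (n * (1 / n) powr t)" by simp
    also have "n * (1 / n) powr t = real n powr (1 - t)"
      using n by (simp add: powr_diff powr_divide)
    finally have "1 \<le> C * real n powr (1 - t)" .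
    also have "1 - t = - (t - 1)" by simp
    finally show ?thesis
      using n by (simp only: powr_minus) (simp add: field_simps)
  qed
  obtain n :: nat where n: "C powr (1 / (t - 1)) < n"
    using reals_Archimedean2 by blast
  have "0 < real n" by (rule less_trans[OF _ n]) (use C in simp)
  then have "n > 0" by simp
  have "C = (C powr (1 / (t - 1))) powr (t - 1)"
    using C t by (simp add: powr_powr)
  also have "\<dots> < real n powr (t - 1)"
    using n t by (intro powr_less_mono2) auto
  finally show False using bound[OF \<open>n > 0\<close>] by simp
qed

text \<open>Windows of length \<open>g ^ q\<close> have mass at most \<open>\<theta> ^ q\<close>,
  and \<open>t\<close> is the solution of \<open>g powr t = \<theta>\<close>. The factor
  \<open>1 / \<theta>\<close> pays for rounding a length up to a power of \<open>g\<close>. The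
  assumption \<open>4 * n + 1 < 2 ^ m\<close> says \<open>\<theta> < 1\<close>, whence
  \<open>t > 0\<close>.\<close>

lemma frostman_ge:
  assumes "1 \<le> n" "2 * \<beta> ^ n - 1 \<le> \<beta> ^ (n * m) / 2" "4 * n + 1 < 2 ^ m"
  defines "t \<equiv> (real m * ln 2 - ln (4 * real n + 1)) / (real n * real m * - ln \<beta>)"
  shows "\<exists>C>0. \<forall>I. is_interval I \<and> I \<subseteq> {0..1} \<longrightarrow> measure \<nu> I \<le> C * measure lborel I powr t"
proof -
  define \<theta> where "\<theta> = (4 * n + 1) / (2 :: real) ^ m"
  define g where "g = \<beta> ^ (n * m)"
  have "m \<noteq> 0" using assms(3) by (intro notI) simp
  then have g: "0 < g" "g < 1" using \<beta> assms(1) by (auto simp: g_def power_less_one_iff)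
  have "real (4 * n + 1) < real (2 ^ m)" using assms(3) by (subst of_nat_less_iff)
  then have \<theta>: "0 < \<theta>" "\<theta> < 1" by (auto simp: \<theta>_def)
  have t_eq: "t = ln \<theta> / ln g"
  proof -
    have "ln \<theta> = - (real m * ln 2 - ln (4 * real n + 1))"
      by (simp add: \<theta>_def ln_div ln_realpow add.commute)
    moreover have "ln g = - (real n * real m * - ln \<beta>)"
      using \<beta> by (simp add: g_def ln_realpow)
    ultimately show ?thesis
      unfolding t_def by (simp only: minus_divide_divide)
  qed
  with g \<theta> have gt: "g powr t = \<theta>"
    by (simp add: powr_def)
  have window: "measure \<nu> {a..a + g ^ q} \<le> \<theta> ^ q" for a q
    using measure_window_power_le[OF assms(1,2), of a q] by (simp add: g_def \<theta>_def add.commute)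
  show ?thesis
  proof (intro exI[of _ "1 / \<theta>"] conjI allI impI)
    fix I :: "real set" assume I: "is_interval I \<and> I \<subseteq> {0..1}"
    show "measure \<nu> I \<le> 1 / \<theta> * measure lborel I powr t"
    proof (cases "I = {}")
      case False
      then obtain a b where ab: "0 \<le> a" "a \<le> b" "b \<le> 1" "I \<subseteq> {a..b}" "measure lborel I = b - a"
        using interval_unit_bounds I by blast
      have mono: "measure \<nu> I \<le> measure \<nu> {a..a + l}" if "b - a \<le> l" for l
        using ab that by (intro finite_measure_mono) auto
      show ?thesis
      proof (cases "a = b")
        \<comment> \<open>For a degenerate interval the right-hand side is 0, because
          \<open>0 powr t = 0\<close>; the claim is that there are no atoms.\<close>
        case True
        have "measure \<nu> I \<le> \<theta> ^ q" for q
          using mono[of "g ^ q"] window[of a q] True g by auto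
        moreover have "(\<lambda>q. \<theta> ^ q) \<longlonglongrightarrow> 0"
          using \<theta> by (intro LIMSEQ_power_zero) auto
        ultimately have "measure \<nu> I \<le> 0"
          by (meson LIMSEQ_le_const)
        then show ?thesis using True ab by simp
      next
        case False
        obtain q where q: "g ^ Suc q < b - a" "b - a \<le> g ^ q"
          using exists_power_bracket[of g "b - a"] g ab False by auto
        have "0 < t"
          using g \<theta> by (simp add: t_eq divide_neg_neg)
        then have "(g ^ Suc q) powr t \<le> (b - a) powr t"
          using q g by (intro powr_mono2) auto
        moreover have "(g ^ Suc q) powr t = \<theta> ^ Suc q"
          using g gt by (metis powr_powr powr_realpow mult.commute powr_gt_zero \<theta>(1))
        moreover have "measure \<nu> I \<le> \<theta> ^ q"
          using mono[OF q(2)] window[of a q] by simp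
        then have "\<theta> * measure \<nu> I \<le> \<theta> ^ Suc q"
          using \<theta> by (auto intro: mult_left_mono)
        ultimately have "\<theta> * measure \<nu> I \<le> (b - a) powr t"
          by linarith
        then show ?thesis
          unfolding ab(5) using \<theta> by (simp add: field_simps)
      qed
    qed auto
  qed (use \<theta> in auto)
qed

end

section \<open>Bounds and limit of the Frostman exponent\<close>

lemma frostman_set_le_1:
  assumes "0 < \<beta>" "\<beta> < 1" "t \<in> frostman_set \<beta>"
  shows "t \<le> 1"
proof -
  interpret self_similar_prob \<beta> "bernoulli_conv \<beta>"
    using self_similar_bernoulli_conv assms by blast
  obtain C where C: "C > 0" "\<And>I. is_interval I \<and> I \<subseteq> {0..1} \<Longrightarrow>
      measure (bernoulli_conv \<beta>) I \<le> C * measure lborel I powr t"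
    using assms by (auto simp: frostman_set_def)
  show ?thesis
  proof (rule frostman_le_1[OF C(1)])
    fix a b :: real assume "0 \<le> a" "a < b" "b \<le> 1"
    then show "measure (bernoulli_conv \<beta>) {a..b} \<le> C * (b - a) powr t"
      using C(2)[of "{a..b}"] by (simp add: is_interval_cc)
  qed
qed

lemma frostman_set_lower:
  assumes "0 < \<beta>" "\<beta> < 1" "1 \<le> n" "2 * \<beta> ^ n - 1 \<le> \<beta> ^ (n * m) / 2" "4 * n + 1 < 2 ^ m"
  shows "(real m * ln 2 - ln (4 * real n + 1)) / (real n * real m * - ln \<beta>) \<in> frostman_set \<beta>"
proof -
  interpret self_similar_prob \<beta> "bernoulli_conv \<beta>"
    using self_similar_bernoulli_conv assms by blast
  show ?thesis
    using frostman_ge[OF assms(3-5)] by (simp add: frostman_set_def)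
qed

lemma le_frostman_exponent:
  assumes "0 < \<beta>" "\<beta> < 1" "t \<in> frostman_set \<beta>"
  shows "t \<le> frostman_exponent \<beta>"
  unfolding frostman_exponent_eq
  using assms frostman_set_le_1 by (intro cSup_upper) (auto intro!: bdd_aboveI)

lemma frostman_exponent_lower:
  assumes "0 < \<beta>" "\<beta> < 1" "1 \<le> n" "2 * \<beta> ^ n - 1 \<le> \<beta> ^ (n * m) / 2" "4 * n + 1 < 2 ^ m"
  shows "(real m * ln 2 - ln (4 * real n + 1)) / (real n * real m * - ln \<beta>) \<le> frostman_exponent \<beta>"
  using frostman_set_lower[OF assms] le_frostman_exponent assms by blast

lemma eventually_lt_power_2: "eventually (\<lambda>m. 4 * n + 1 < (2 :: nat) ^ m) sequentially"
proof (rule eventually_sequentiallyI)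
  fix m assume "4 * n + 1 \<le> m"
  also have "m < 2 ^ m" by (rule less_exp)
  finally show "4 * n + 1 < 2 ^ m" .
qed

text \<open>The loss \<open>ln (4 * real n + 1)\<close> is shared among \<open>m\<close> blocks and
  disappears. The limit is only approached by elements of the Frostman set, which is enough for a
  supremum.\<close>

lemma frostman_lower_tendsto:
  assumes "ln \<beta> \<noteq> 0" "1 \<le> n"
  shows "(\<lambda>m. (real m * ln 2 - ln (4 * real n + 1)) / (real n * real m * - ln \<beta>)) \<longlonglongrightarrow> ln 2 / (real n * - ln \<beta>)"
proof -
  have "(\<lambda>m. (ln 2 - ln (4 * real n + 1) / real m) / (real n * - ln \<beta>)) \<longlonglongrightarrow> (ln 2 - 0) / (real n * - ln \<beta>)"
    using assms by (intro tendsto_intros tendsto_divide_0[OF tendsto_const] filterlim_at_top_imp_at_infinity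
        filterlim_real_sequentially) auto
  moreover have "eventually (\<lambda>m. (ln 2 - ln (4 * real n + 1) / real m) / (real n * - ln \<beta>)
      = (real m * ln 2 - ln (4 * real n + 1)) / (real n * real m * - ln \<beta>)) sequentially"
    using eventually_gt_at_top[of 0] by eventually_elim (use assms in \<open>simp add: field_simps\<close>)
  ultimately show ?thesis
    unfolding diff_0_right by (rule Lim_transform_eventually)
qed

lemma frostman_set_nonempty:
  assumes "0 < \<beta>" "\<beta> < 1"
  shows "frostman_set \<beta> \<noteq> {}"
proof -
  obtain n where n: "1 \<le> n" "\<beta> ^ n \<le> 1/2"
    using exists_power_le_half assms by blast
  obtain m where "4 * n + 1 < 2 ^ m"
    using eventually_happens[OF eventually_lt_power_2] by auto
  moreover have "2 * \<beta> ^ n - 1 \<le> 0" "0 \<le> \<beta> ^ (n * m) / 2"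
    using n assms by auto
  ultimately show ?thesis
    using frostman_set_lower[OF assms n(1), of m] by force
qed

lemma frostman_exponent_le_1:
  assumes "0 < \<beta>" "\<beta> < 1"
  shows "frostman_exponent \<beta> \<le> 1"
  unfolding frostman_exponent_eq
  using assms frostman_set_le_1 frostman_set_nonempty by (intro cSup_least) auto

lemma frostman_exponent_gt_half:
  assumes "1/2 < \<beta>" "\<beta> < 1"
  shows "1/2 < frostman_exponent \<beta>"
proof -
  have "ln \<beta> < 0" using assms by simp
  have "\<exists>n. \<beta> ^ n \<le> 1/2"
    using exists_power_le_half[of \<beta>] assms by auto
  then obtain n where n: "\<beta> ^ n \<le> 1/2" "\<And>i. i < n \<Longrightarrow> \<not> \<beta> ^ i \<le> 1/2"
    using exists_least_iff[of "\<lambda>n. \<beta> ^ n \<le> 1/2"] by blast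
  have "n \<noteq> 0" using n(1) by (intro notI) simp
  \<comment> \<open>Here \<open>\<beta> > 1/2\<close> enters. Minimality of \<open>n\<close> gives
    \<open>(n - 1) * (- ln \<beta>) < ln 2\<close>, and \<open>n / 2 \<le> n - 1\<close> for
    \<open>n \<ge> 2\<close> turns this into a ratio strictly above 1/2; the strictness leaves room
    for a finite \<open>m\<close>.\<close>
  moreover have "n \<noteq> 1" using n(1) assms by (intro notI) simp
  ultimately have "n \<ge> 2" by simp
  have "ln (1/2) < ln (\<beta> ^ (n - 1))"
    using n(2)[of "n - 1"] \<open>n \<ge> 2\<close> assms by (subst ln_less_cancel_iff) auto
  then have "(real n - 1) * (- ln \<beta>) < ln 2"
    using assms \<open>n \<ge> 2\<close> by (simp add: ln_realpow ln_div of_nat_diff)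
  moreover have "(real n / 2) * (- ln \<beta>) \<le> (real n - 1) * (- ln \<beta>)"
    using \<open>n \<ge> 2\<close> \<open>ln \<beta> < 0\<close> by (intro mult_right_mono) auto
  ultimately have "1/2 * (real n * - ln \<beta>) < ln 2"
    by simp
  then have "1/2 < ln 2 / (real n * - ln \<beta>)"
    using \<open>n \<ge> 2\<close> \<open>ln \<beta> < 0\<close> by (subst pos_less_divide_eq) (auto simp: mult_neg_pos mult_pos_neg)
  then have "eventually (\<lambda>m. 1/2 < (real m * ln 2 - ln (4 * real n + 1)) / (real n * real m * - ln \<beta>)) sequentially"
    using \<open>n \<ge> 2\<close> \<open>ln \<beta> < 0\<close> by (intro order_tendstoD[OF frostman_lower_tendsto]) auto
  then obtain m where m: "1/2 < (real m * ln 2 - ln (4 * real n + 1)) / (real n * real m * - ln \<beta>)" "4 * n + 1 < 2 ^ m"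
    using eventually_happens[OF eventually_conj[OF _ eventually_lt_power_2]] by auto
  have "2 * \<beta> ^ n - 1 \<le> 0" "0 \<le> \<beta> ^ (n * m) / 2"
    using n assms by auto
  then have "2 * \<beta> ^ n - 1 \<le> \<beta> ^ (n * m) / 2"
    by linarith
  then show ?thesis
    using assms \<open>n \<ge> 2\<close> by (intro less_le_trans[OF m(1) frostman_exponent_lower[OF _ _ _ _ m(2)]]) auto
qed

text \<open>First \<open>m\<close> is fixed so that the lower bound at the limit point
  \<open>b\<close> exceeds \<open>e\<close>. The overlap condition for this \<open>m\<close> and the
  bound itself are strict at \<open>b\<close> and continuous in \<open>\<beta>\<close>, so they
  persist nearby on both sides of \<open>b\<close>.\<close>

lemma frostman_exponent_tendsto_1:
  assumes "1 \<le> n"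
  shows "(frostman_exponent \<longlongrightarrow> 1) (at (2 powr (- 1 / real n)) within {1/2<..<1})"
proof (rule order_tendstoI)
  let ?F = "at (2 powr (- 1 / real n)) within {1/2<..<1 :: real}"
  define b where "b = 2 powr (- 1 / real n)"
  have b: "0 < b" "b < 1" using assms by (auto simp: b_def powr_less_one)
  have lnb: "ln b = - ln 2 / n" by (simp add: b_def ln_powr)
  have "b ^ n = b powr n"
    using b by (simp add: powr_realpow)
  also have "\<dots> = 2 powr (- 1)"
    using assms unfolding b_def by (subst powr_powr) simp
  finally have bn: "b ^ n = 1/2"
    by (simp add: powr_minus_divide)
  have ev: "eventually (\<lambda>\<beta>. \<beta> \<in> {1/2<..<1}) ?F"
    by (auto simp: eventually_at_filter)
  have lim: "((\<lambda>\<beta>. \<beta>) \<longlongrightarrow> b) ?F"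
    unfolding b_def by (rule tendsto_ident_at)
  {
    fix e :: real assume "1 < e"
    show "eventually (\<lambda>\<beta>. frostman_exponent \<beta> < e) ?F"
      using ev
    proof eventually_elim
      case (elim \<beta>)
      then show ?case
        using frostman_exponent_le_1[of \<beta>] \<open>1 < e\<close> by auto
    qed
  }
  {
    fix e :: real assume "e < 1"
    have "ln 2 / (real n * - ln b) = 1" using assms by (simp add: lnb)
    then have "eventually (\<lambda>m. e < (real m * ln 2 - ln (4 * real n + 1)) / (real n * real m * - ln b)) sequentially"
      using assms b \<open>e < 1\<close> by (intro order_tendstoD[OF frostman_lower_tendsto]) auto
    then obtain m where m: "e < (real m * ln 2 - ln (4 * real n + 1)) / (real n * real m * - ln b)" "4 * n + 1 < 2 ^ m"
      using eventually_happens[OF eventually_conj[OF _ eventually_lt_power_2]] by auto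
    have "m \<noteq> 0" using m(2) by (intro notI) simp
    have "eventually (\<lambda>\<beta>. e < (real m * ln 2 - ln (4 * real n + 1)) / (real n * real m * - ln \<beta>)) ?F"
      using b assms \<open>m \<noteq> 0\<close>
      by (intro order_tendstoD[OF _ m(1)] tendsto_divide tendsto_mult tendsto_const tendsto_minus tendsto_ln lim) auto
    \<comment> \<open>At \<open>b\<close> the overlap \<open>2 * b ^ n - 1\<close> is 0, while the
      tolerance \<open>b ^ (n * m) / 2\<close> is positive for fixed \<open>m\<close>.\<close>
    moreover have "eventually (\<lambda>\<beta>. 0 < \<beta> ^ (n * m) / 2 - (2 * \<beta> ^ n - 1)) ?F"
    proof (rule order_tendstoD)
      show "((\<lambda>\<beta>. \<beta> ^ (n * m) / 2 - (2 * \<beta> ^ n - 1)) \<longlongrightarrow> b ^ (n * m) / 2 - (2 * b ^ n - 1)) ?F"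
        by (intro tendsto_diff tendsto_divide tendsto_mult tendsto_const tendsto_power lim) auto
      show "0 < b ^ (n * m) / 2 - (2 * b ^ n - 1)"
        unfolding bn using b(1) by simp
    qed
    ultimately show "eventually (\<lambda>\<beta>. e < frostman_exponent \<beta>) ?F"
      using ev
    proof eventually_elim
      case (elim \<beta>)
      then show ?case
        using frostman_exponent_lower[of \<beta> n m] m(2) assms by force
    qed
  }
qed

section \<open>The attractor\<close>

text \<open>A point of \<open>G\<close> farthest from \<open>H\<close> is the image of a point of
  \<open>G\<close>, and both maps shrink the distance to \<open>H\<close> by \<open>c\<close>; so
  the largest distance is at most \<open>c\<close> times itself and vanishes. The two inclusions are
  one-sided so that the result gives uniqueness, containment in the square and the projection
  alike.\<close>

lemma invariant_subset:
  fixes f g :: "'a::heine_borel \<Rightarrow> 'a"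
  assumes c: "0 \<le> c" "c < 1"
    and f: "\<And>x y. dist (f x) (f y) \<le> c * dist x y"
    and g: "\<And>x y. dist (g x) (g y) \<le> c * dist x y"
    and G: "compact G" "G \<subseteq> f ` G \<union> g ` G"
    and H: "closed H" "H \<noteq> {}" "f ` H \<union> g ` H \<subseteq> H"
  shows "G \<subseteq> H"
proof (cases "G = {}")
  case False
  have "continuous_on G (\<lambda>x. infdist x H)"
    by (intro continuous_intros)
  then obtain z where z: "z \<in> G" "\<And>x. x \<in> G \<Longrightarrow> infdist x H \<le> infdist z H"
    using continuous_attains_sup[OF G(1) False] by blast
  have step: "infdist (h x) H \<le> c * infdist x H"
    if h: "\<And>x y. dist (h x) (h y) \<le> c * dist x y" "h ` H \<subseteq> H" for h x
  proof -
    obtain y where y: "y \<in> H" "infdist x H = dist x y"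
      using infdist_attains_inf H(1,2) by blast
    have "infdist (h x) H \<le> dist (h x) (h y)"
      using y h by (intro infdist_le) auto
    also have "\<dots> \<le> c * infdist x H" unfolding y(2) by (rule h)
    finally show ?thesis .
  qed
  obtain x h where x: "x \<in> G" "z = h x" "h = f \<or> h = g"
    using z(1) G(2) by blast
  have "infdist z H \<le> c * infdist x H"
    unfolding x(2) using x(3) f g H(3) by (intro step) auto
  also have "\<dots> \<le> c * infdist z H"
    using z(2)[OF x(1)] c by (intro mult_left_mono) auto
  finally have "(1 - c) * infdist z H \<le> 0"
    by (simp add: algebra_simps)
  then have "infdist z H \<le> 0"
    using c by (simp add: mult_le_0_iff)
  show ?thesis
  proof
    fix x assume "x \<in> G"
    then have "infdist x H = 0"
      using z(2) \<open>infdist z H \<le> 0\<close> infdist_nonneg[of x H] by force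
    then show "x \<in> H"
      using H in_closed_iff_infdist_zero by blast
  qed
qed auto

lemma dist_affine_pair_le:
  assumes "0 \<le> a" "a \<le> c" "0 \<le> b" "b \<le> c"
  shows "dist (a * x + p, b * y + q) (a * x' + p, b * y' + q) \<le> c * dist (x, y) (x', y' :: real)"
proof -
  have "(a * (x - x'))\<^sup>2 + (b * (y - y'))\<^sup>2 \<le> (c * (x - x'))\<^sup>2 + (c * (y - y'))\<^sup>2"
    unfolding power_mult_distrib using assms by (intro add_mono mult_right_mono power_mono) auto
  also have "\<dots> = c\<^sup>2 * ((x - x')\<^sup>2 + (y - y')\<^sup>2)"
    by (simp add: distrib_left power_mult_distrib)
  finally have "sqrt ((a * (x - x'))\<^sup>2 + (b * (y - y'))\<^sup>2) \<le> c * sqrt ((x - x')\<^sup>2 + (y - y')\<^sup>2)"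
    using assms by (intro real_le_lsqrt) (auto simp: power_mult_distrib)
  then show ?thesis
    by (simp add: dist_Pair_Pair dist_real_def algebra_simps)
qed

locale carpet =
  fixes \<alpha> \<beta> :: real
  assumes \<alpha>: "0 < \<alpha>" "\<alpha> \<le> 1/2" and \<beta>: "1/2 < \<beta>" "\<beta> < 1"
begin

lemma \<beta>_pos: "0 < \<beta>" and \<alpha>_less_1: "\<alpha> < 1"
  using \<alpha> \<beta> by auto

lemma dist_S_le:
  "dist (S1 \<alpha> \<beta> z) (S1 \<alpha> \<beta> z') \<le> \<beta> * dist z z'"
  "dist (S2 \<alpha> \<beta> z) (S2 \<alpha> \<beta> z') \<le> \<beta> * dist z z'"
  using dist_affine_pair_le[of \<beta> \<beta> \<alpha> "fst z" 0 "snd z" 0 "fst z'" "snd z'"]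
    dist_affine_pair_le[of \<beta> \<beta> \<alpha> "fst z" "1 - \<beta>" "snd z" "1 - \<alpha>" "fst z'" "snd z'"] \<alpha> \<beta>
  by (auto simp: S1_def S2_def split_beta algebra_simps)

lemma inj_S: "inj (S1 \<alpha> \<beta>)" "inj (S2 \<alpha> \<beta>)"
  using \<alpha> \<beta> by (auto simp: inj_def S1_def S2_def)

lemma continuous_on_S: "continuous_on A (S1 \<alpha> \<beta>)" "continuous_on A (S2 \<alpha> \<beta>)"
  unfolding S1_def S2_def split_beta by (intro continuous_intros)+

definition iterate :: "nat \<Rightarrow> (real \<times> real) set" where
  "iterate n = ((\<lambda>A. S1 \<alpha> \<beta> ` A \<union> S2 \<alpha> \<beta> ` A) ^^ n) ({0..1} \<times> {0..1})"

lemma iterate_0: "iterate 0 = {0..1} \<times> {0..1}"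
  and iterate_Suc: "iterate (Suc n) = S1 \<alpha> \<beta> ` iterate n \<union> S2 \<alpha> \<beta> ` iterate n"
  by (simp_all add: iterate_def)

lemma S_unit_square: "S1 \<alpha> \<beta> ` ({0..1} \<times> {0..1}) \<union> S2 \<alpha> \<beta> ` ({0..1} \<times> {0..1}) \<subseteq> {0..1} \<times> {0..1}"
proof -
  have c: "0 \<le> c * t \<and> c * t \<le> c" if "0 \<le> t \<and> t \<le> 1" "0 < c" for c t :: real
    using that by (auto simp: mult_left_le)
  have "S1 \<alpha> \<beta> (x, y) \<in> {0..1} \<times> {0..1} \<and> S2 \<alpha> \<beta> (x, y) \<in> {0..1} \<times> {0..1}"
    if "x \<in> {0..1}" "y \<in> {0..1}" for x y
  proof -
    have "0 \<le> \<beta> * x \<and> \<beta> * x \<le> \<beta>" "0 \<le> \<alpha> * y \<and> \<alpha> * y \<le> \<alpha>"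
      using that \<alpha> \<beta> by (auto intro!: c)
    then show ?thesis
      unfolding S1_def S2_def split_conv mem_Times_iff fst_conv snd_conv atLeastAtMost_iff
      using \<alpha> \<beta> by (intro conjI; linarith)
  qed
  then show ?thesis
    by blast
qed

lemma attractor_exists: "\<exists>F. F \<noteq> {} \<and> compact F \<and> F = S1 \<alpha> \<beta> ` F \<union> S2 \<alpha> \<beta> ` F"
proof -
  define F where "F = (\<Inter>n. iterate n)"
  have compact: "compact (iterate n)" for n
    by (induction n)
      (auto simp: iterate_0 iterate_Suc intro!: compact_Times compact_Un compact_continuous_image continuous_on_S)
  have Suc_subset: "iterate (Suc n) \<subseteq> iterate n" for n
  proof (induction n)
    case 0
    then show ?case using S_unit_square by (simp add: iterate_0 iterate_Suc)
  next
    case (Suc n)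
    then show ?case by (subst (1 2) iterate_Suc) blast
  qed
  have anti: "iterate n \<subseteq> iterate m" if "m \<le> n" for m n
    using lift_Suc_antimono_le[of iterate] Suc_subset that by blast
  have "(0, 0) \<in> iterate n" for n
  proof (induction n)
    case (Suc n)
    have "(0, 0) = S1 \<alpha> \<beta> (0, 0)" by (simp add: S1_def)
    with Suc show ?case by (auto simp: iterate_Suc intro: image_eqI)
  qed (simp add: iterate_0)
  then have "F \<noteq> {}" by (auto simp: F_def)
  moreover have "compact F"
    unfolding F_def using compact by (intro compact_Inter) auto
  moreover have "F = S1 \<alpha> \<beta> ` F \<union> S2 \<alpha> \<beta> ` F"
  proof
    have "S1 \<alpha> \<beta> ` F \<union> S2 \<alpha> \<beta> ` F \<subseteq> iterate (Suc n)" for n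
      unfolding F_def iterate_Suc by blast
    then show "S1 \<alpha> \<beta> ` F \<union> S2 \<alpha> \<beta> ` F \<subseteq> F"
      using Suc_subset unfolding F_def by blast
    show "F \<subseteq> S1 \<alpha> \<beta> ` F \<union> S2 \<alpha> \<beta> ` F"
    proof
      fix z assume "z \<in> F"
      then have z: "z \<in> S1 \<alpha> \<beta> ` iterate n \<or> z \<in> S2 \<alpha> \<beta> ` iterate n" for n
        using iterate_Suc[of n] by (auto simp: F_def)
      \<comment> \<open>Injectivity lets the image commute with the intersection. As the iterates
        decrease, a point that leaves the images under \<open>S1\<close> at some stage must lie in
        all images under \<open>S2\<close>.\<close>
      have lim: "z \<in> h ` F" if "inj h" "\<forall>n. z \<in> h ` iterate n" for h
        unfolding F_def image_INT[OF \<open>inj h\<close>, of UNIV iterate] using that by (subst image_INT[OF that(1)]) auto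
      show "z \<in> S1 \<alpha> \<beta> ` F \<union> S2 \<alpha> \<beta> ` F"
      proof (cases "\<forall>n. z \<in> S1 \<alpha> \<beta> ` iterate n")
        case True
        then show ?thesis using lim inj_S by blast
      next
        case False
        then obtain m where m: "z \<notin> S1 \<alpha> \<beta> ` iterate m" by blast
        have "z \<in> S2 \<alpha> \<beta> ` iterate n" for n
        proof -
          have "z \<notin> S1 \<alpha> \<beta> ` iterate (max m n)"
            using m anti[of m "max m n"] by auto
          then have "z \<in> S2 \<alpha> \<beta> ` iterate (max m n)" using z by blast
          then show ?thesis using anti[of n "max m n"] by auto
        qed
        then show ?thesis using lim inj_S by blast
      qed
    qed
  qed
  ultimately show ?thesis by blast
qed

abbreviation "F \<equiv> attractor \<alpha> \<beta>"

lemma F: "F \<noteq> {}" "compact F" "F = S1 \<alpha> \<beta> ` F \<union> S2 \<alpha> \<beta> ` F"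
proof -
  have "\<exists>!F. F \<noteq> {} \<and> compact F \<and> F = S1 \<alpha> \<beta> ` F \<union> S2 \<alpha> \<beta> ` F"
  proof (rule ex_ex1I[OF attractor_exists])
    fix G H assume *: "G \<noteq> {} \<and> compact G \<and> G = S1 \<alpha> \<beta> ` G \<union> S2 \<alpha> \<beta> ` G"
      "H \<noteq> {} \<and> compact H \<and> H = S1 \<alpha> \<beta> ` H \<union> S2 \<alpha> \<beta> ` H"
    have "A \<subseteq> B" if "compact A" "A \<subseteq> S1 \<alpha> \<beta> ` A \<union> S2 \<alpha> \<beta> ` A" "B \<noteq> {}" "compact B" "S1 \<alpha> \<beta> ` B \<union> S2 \<alpha> \<beta> ` B \<subseteq> B" for A B
      by (rule invariant_subset[of \<beta> "S1 \<alpha> \<beta>" "S2 \<alpha> \<beta>"])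
        (use that dist_S_le \<beta> in \<open>auto intro: compact_imp_closed\<close>)
    then show "G = H" using * by (metis order_antisym order_refl)
  qed
  from theI'[OF this] show "F \<noteq> {}" "compact F" "F = S1 \<alpha> \<beta> ` F \<union> S2 \<alpha> \<beta> ` F"
    unfolding attractor_def by auto
qed

lemma F_subset_square: "F \<subseteq> {0..1} \<times> {0..1}"
proof (rule invariant_subset[of \<beta> "S1 \<alpha> \<beta>" "S2 \<alpha> \<beta>"])
  show "closed ({0..1} \<times> {0..1} :: (real \<times> real) set)" by (intro closed_Times) auto
  show "F \<subseteq> S1 \<alpha> \<beta> ` F \<union> S2 \<alpha> \<beta> ` F"
    using F(3) by (rule equalityD1)
qed (use F(2) dist_S_le \<beta> S_unit_square in auto)

lemma bounded_F: "bounded F"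
  using F(2) by (rule compact_imp_bounded)

text \<open>For \<open>\<beta> > 1/2\<close> the two horizontal images cover [0,1]. Consequently
  every abscissa in the base of a cylinder is attained, which the lower covering bound needs in
  order to place its points.\<close>

lemma fst_F: "fst ` F = {0..1}"
proof
  show "fst ` F \<subseteq> {0..1}" using F_subset_square by auto
  show "{0..1} \<subseteq> fst ` F"
  proof (rule invariant_subset[of \<beta> "f1 \<beta>" "f2 \<beta>"])
    show "closed (fst ` F)"
      using F(2) by (intro compact_imp_closed compact_continuous_image continuous_intros)
    have "fst ` (S1 \<alpha> \<beta> ` F) = f1 \<beta> ` fst ` F" "fst ` (S2 \<alpha> \<beta> ` F) = f2 \<beta> ` fst ` F"
      by (auto simp: S1_def S2_def f1_def f2_def image_image split_beta)
    then show "f1 \<beta> ` fst ` F \<union> f2 \<beta> ` fst ` F \<subseteq> fst ` F"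
      using F(3) by (metis image_Un order_refl)
    show "{0..1} \<subseteq> f1 \<beta> ` {0..1} \<union> f2 \<beta> ` {0..1}"
    proof
      fix x :: real assume x: "x \<in> {0..1}"
      show "x \<in> f1 \<beta> ` {0..1} \<union> f2 \<beta> ` {0..1}"
      proof (cases "x \<le> \<beta>")
        case True
        then show ?thesis
          using x \<beta> by (intro UnI1 image_eqI[of _ _ "x / \<beta>"]) (auto simp: f1_def)
      next
        case False
        then show ?thesis
          using x \<beta> by (intro UnI2 image_eqI[of _ _ "(x - (1 - \<beta>)) / \<beta>"]) (auto simp: f2_def field_simps)
      qed
    qed
    show "fst ` F \<noteq> {}" using F(1) by simp
    show "dist (f1 \<beta> x) (f1 \<beta> y) \<le> \<beta> * dist x y" "dist (f2 \<beta> x) (f2 \<beta> y) \<le> \<beta> * dist x y" for x y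
      using \<beta> by (auto simp: f1_def f2_def dist_real_def abs_mult simp flip: right_diff_distrib)
  qed (use \<beta> in auto)
qed

text \<open>The composition of the planar maps coded by \<open>w\<close>, in closed form;
  \<open>cyl_Cons\<close> confirms it.\<close>

definition cyl :: "bool list \<Rightarrow> real \<times> real \<Rightarrow> real \<times> real" where
  "cyl w z = (pos \<beta> w + \<beta> ^ length w * fst z, pos \<alpha> w + \<alpha> ^ length w * snd z)"

lemma cyl_Cons: "cyl (b # w) z = (if b then S2 \<alpha> \<beta> else S1 \<alpha> \<beta>) (cyl w z)"
  by (auto simp: cyl_def S1_def S2_def algebra_simps)

lemma cyl_in_F: "z \<in> F \<Longrightarrow> cyl w z \<in> F"
proof (induction w)
  case (Cons b w)
  then show ?case
    using equalityD2[OF F(3)] unfolding cyl_Cons by auto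
qed (simp add: cyl_def)

lemma F_eq_cyl: "F = (\<Union>w\<in>words n. cyl w ` F)"
proof
  show "F \<subseteq> (\<Union>w\<in>words n. cyl w ` F)"
  proof (induction n)
    case (Suc n)
    show ?case
    proof
      fix z assume "z \<in> F"
      then obtain z' where z': "z' \<in> F" "z = S2 \<alpha> \<beta> z' \<or> z = S1 \<alpha> \<beta> z'"
        using equalityD1[OF F(3)] by blast
      define b where "b \<longleftrightarrow> z = S2 \<alpha> \<beta> z'"
      obtain w y where w: "w \<in> words n" "y \<in> F" "z' = cyl w y"
        using Suc z' by blast
      then have "z = cyl (b # w) y" "b # w \<in> words (Suc n)"
        using z' by (auto simp: b_def cyl_Cons words_def)
      with w show "z \<in> (\<Union>w\<in>words (Suc n). cyl w ` F)" by blast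
    qed
  qed (simp add: words_0 cyl_def)
qed (auto intro: cyl_in_F)

lemma fst_cyl_image:
  assumes "w \<in> words n"
  shows "fst ` cyl w ` F = {pos \<beta> w..pos \<beta> w + \<beta> ^ n}"
proof -
  have "fst ` cyl w ` F = (\<lambda>x. \<beta> ^ n * x + pos \<beta> w) ` fst ` F"
    by (simp only: image_image cyl_def fst_conv length_words[OF assms] add.commute)
  also have "\<dots> = {pos \<beta> w..pos \<beta> w + \<beta> ^ n}"
    unfolding fst_F using \<beta>_pos by (simp only: image_affinity_atLeastAtMost) (simp add: add.commute)
  finally show ?thesis .
qed

lemma snd_cyl: "w \<in> words n \<Longrightarrow> z \<in> F \<Longrightarrow> snd (cyl w z) \<in> {pos \<alpha> w..pos \<alpha> w + \<alpha> ^ n}"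
  using F_subset_square \<alpha> by (auto simp: cyl_def words_def mult_left_le)

end

section \<open>Covering numbers\<close>

definition fine_cover :: "real \<Rightarrow> 'a::euclidean_space set \<Rightarrow> 'a set set \<Rightarrow> bool" where
  "fine_cover r A \<U> \<longleftrightarrow>
     finite \<U> \<and> A \<subseteq> \<Union>\<U> \<and> (\<forall>U\<in>\<U>. open U \<and> bounded U \<and> diameter U \<le> r)"

lemma covering_number_eq_Least:
  "covering_number r A = (LEAST k. \<exists>\<U>. fine_cover r A \<U> \<and> card \<U> = k)"
  unfolding covering_number_def fine_cover_def by (rule arg_cong[where f = Least]) auto

lemma covering_number_le: "fine_cover r A \<U> \<Longrightarrow> covering_number r A \<le> card \<U>"
  unfolding covering_number_eq_Least by (rule Least_le) blast

lemma fine_cover_balls: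
  assumes "finite P" "0 < r" "A \<subseteq> (\<Union>p\<in>P. ball p (r / 2))"
  shows "fine_cover r A ((\<lambda>p. ball p (r / 2)) ` P)"
  using assms by (auto simp: fine_cover_def diameter_ball)

lemma covering_number_attained:
  fixes A :: "'a::euclidean_space set"
  assumes "bounded A" "0 < r"
  obtains \<U> where "fine_cover r A \<U>" "card \<U> = covering_number r A"
proof -
  have "compact (closure A)" using assms by (simp add: compact_closure)
  then obtain P where "finite P" "closure A \<subseteq> (\<Union>p\<in>P. ball p (r / 2))"
    using seq_compact_imp_totally_bounded[of "closure A"] assms(2)
    by (meson compact_imp_seq_compact half_gt_zero)
  then have "fine_cover r A ((\<lambda>p. ball p (r / 2)) ` P)"
    using assms(2) closure_subset[of A] by (intro fine_cover_balls) auto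
  then have "\<exists>\<U>. fine_cover r A \<U> \<and> card \<U> = covering_number r A"
    unfolding covering_number_eq_Least by (rule_tac LeastI_ex) blast
  then show ?thesis using that by blast
qed

lemma covering_number_mono:
  assumes "A \<subseteq> B" "0 < r" "r \<le> r'" "bounded B"
  shows "covering_number r' A \<le> covering_number r B"
proof -
  obtain \<U> where "fine_cover r B \<U>" "card \<U> = covering_number r B"
    using covering_number_attained assms by blast
  moreover from this have "fine_cover r' A \<U>"
    using assms by (auto simp: fine_cover_def)
  ultimately show ?thesis
    using covering_number_le by metis
qed

lemma covering_number_balls_le:
  assumes "finite P" "0 < r" "A \<subseteq> (\<Union>p\<in>P. ball p (r / 2))"
  shows "covering_number r A \<le> card P"
  using covering_number_le[OF fine_cover_balls[OF assms]] card_image_le[OF assms(1)] order_trans by blast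

lemma dist_Pair_le: "dist (a, b) (c, d) \<le> \<bar>a - c\<bar> + \<bar>b - d :: real\<bar>"
  unfolding dist_Pair_Pair dist_real_def by (simp add: sqrt_sum_squares_le_sum_abs)

text \<open>After taking logarithms the constants become additive terms, which vanish on division by
  \<open>- ln r\<close>. The lower bound also shows that the covering number is positive, so its
  logarithm is monotone in the estimate.\<close>

lemma box_dim_eqI:
  fixes E :: "'a::euclidean_space set"
  assumes "0 < c" "0 < C"
    and lower: "\<And>r. 0 < r \<Longrightarrow> r < 1 \<Longrightarrow> c * r powr - d \<le> covering_number r E"
    and upper: "\<And>r. 0 < r \<Longrightarrow> r < 1 \<Longrightarrow> covering_number r E \<le> C * r powr - d"
  shows "box_dim E = d"
proof -
  have ln_lim: "filterlim (\<lambda>r. - ln r :: real) at_top (at_right 0)"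
    using ln_at_0 by (simp add: filterlim_uminus_at_top)
  have lim: "((\<lambda>r. d + b / (- ln r)) \<longlongrightarrow> d) (at_right 0)" for b :: real
    using tendsto_add[OF tendsto_const[of d] tendsto_divide_0[OF tendsto_const[of b]
        filterlim_at_top_imp_at_infinity[OF ln_lim]]] by simp
  have bounds: "d + ln c / (- ln r) \<le> ln (real (covering_number r E)) / (- ln r) \<and>
      ln (real (covering_number r E)) / (- ln r) \<le> d + ln C / (- ln r)" if r: "0 < r" "r < 1" for r
  proof -
    have l: "0 < - ln r" using r by simp
    have pos: "0 < c * r powr - d" using assms r by simp
    have "ln (c * r powr - d) \<le> ln (real (covering_number r E))"
      "ln (real (covering_number r E)) \<le> ln (C * r powr - d)"
      using lower[OF r] upper[OF r] pos by (simp_all only: ln_le_cancel_iff order_less_le_trans)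
    moreover have "ln (b * r powr - d) = (d + ln b / (- ln r)) * - ln r" if "0 < b" for b
      using that r l by (simp add: ln_mult ln_powr field_simps)
    ultimately have "(d + ln c / (- ln r)) * - ln r \<le> ln (real (covering_number r E))"
      "ln (real (covering_number r E)) \<le> (d + ln C / (- ln r)) * - ln r"
      using assms by metis+
    then show ?thesis
      using l by (simp only: pos_le_divide_eq pos_divide_le_eq)
  qed
  have ev: "eventually (\<lambda>r. 0 < r \<and> r < (1::real)) (at_right 0)"
    using eventually_at_right_real[of 0 1] by (auto elim: eventually_mono)
  have "((\<lambda>r. ln (real (covering_number r E)) / (- ln r)) \<longlongrightarrow> d) (at_right 0)"
    by (rule tendsto_sandwich[OF _ _ lim lim]; use ev in eventually_elim; use bounds in blast)
  then show ?thesis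
    unfolding box_dim_def by (intro tendsto_Lim) auto
qed

section \<open>Covering estimates through cylinders\<close>

context carpet
begin

text \<open>The part of \<open>E\<close> in a cylinder fits in a box of width \<open>L\<close> and
  height at most \<open>\<rho>\<close>. Centres at spacing \<open>\<rho>\<close> along its lower
  edge are within \<open>2 * \<rho>\<close> of all its points, which gives balls of diameter
  \<open>4 * \<rho>\<close>.\<close>

lemma covering_number_upper:
  assumes W: "W \<subseteq> words N" and \<rho>: "\<alpha> ^ N \<le> \<rho>" and L: "0 \<le> L"
    and E: "E \<subseteq> (\<Union>w\<in>W. cyl w ` F)"
    and a: "\<And>w z. w \<in> W \<Longrightarrow> z \<in> E \<Longrightarrow> z \<in> cyl w ` F \<Longrightarrow> fst z \<in> {a w..a w + L}"
  shows "covering_number (4 * \<rho>) E \<le> card W * (L / \<rho> + 1)"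
proof -
  have \<rho>_pos: "0 < \<rho>" using \<rho> \<alpha> by (meson less_le_trans zero_less_power)
  define n where "n = nat \<lfloor>L / \<rho>\<rfloor>"
  define P where "P = (\<Union>w\<in>W. (\<lambda>i. (a w + real i * \<rho>, pos \<alpha> w)) ` {..n})"
  have finW: "finite W" using W finite_words finite_subset by blast
  have "E \<subseteq> (\<Union>p\<in>P. ball p (4 * \<rho> / 2))"
  proof
    fix z assume z: "z \<in> E"
    then obtain w where w: "w \<in> W" "z \<in> cyl w ` F" using E by blast
    have x: "fst z \<in> {a w..a w + L}" using a w z by blast
    have y: "snd z \<in> {pos \<alpha> w..pos \<alpha> w + \<alpha> ^ N}"
      using w W snd_cyl by blast
    define i where "i = nat \<lfloor>(fst z - a w) / \<rho>\<rfloor>"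
    have q: "0 \<le> (fst z - a w) / \<rho>" "(fst z - a w) / \<rho> \<le> L / \<rho>"
      using x \<rho>_pos by (auto intro!: divide_right_mono)
    then have "i \<le> n" unfolding i_def n_def by (intro nat_mono floor_mono)
    have "real i \<le> (fst z - a w) / \<rho>" "(fst z - a w) / \<rho> < real i + 1"
      using q(1) unfolding i_def by (simp_all add: of_nat_nat)
    then have "real i * \<rho> \<le> fst z - a w" "fst z - a w < (real i + 1) * \<rho>"
      using \<rho>_pos by (simp_all add: pos_le_divide_eq pos_divide_less_eq)
    then have "\<bar>(a w + real i * \<rho>) - fst z\<bar> < \<rho>"
      by (simp add: algebra_simps)
    moreover have "\<bar>pos \<alpha> w - snd z\<bar> \<le> \<rho>" using y \<rho> by auto
    ultimately have "dist (a w + real i * \<rho>, pos \<alpha> w) (fst z, snd z) < 2 * \<rho>"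
      using dist_Pair_le[of "a w + real i * \<rho>" "pos \<alpha> w" "fst z" "snd z"] by linarith
    then have "z \<in> ball (a w + real i * \<rho>, pos \<alpha> w) (4 * \<rho> / 2)" by simp
    moreover have "(a w + real i * \<rho>, pos \<alpha> w) \<in> P"
      using w \<open>i \<le> n\<close> by (auto simp: P_def)
    ultimately show "z \<in> (\<Union>p\<in>P. ball p (4 * \<rho> / 2))" by blast
  qed
  moreover have "finite P" unfolding P_def using finW by auto
  ultimately have "covering_number (4 * \<rho>) E \<le> card P"
    using \<rho>_pos by (intro covering_number_balls_le) auto
  also have "card P \<le> (\<Sum>w\<in>W. card ((\<lambda>i. (a w + real i * \<rho>, pos \<alpha> w)) ` {..n}))"
    unfolding P_def using finW by (rule card_UN_le)
  also have "\<dots> \<le> (\<Sum>w\<in>W. n + 1)"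
    by (intro sum_mono order_trans[OF card_image_le]) auto
  finally have "covering_number (4 * \<rho>) E \<le> card W * (n + 1)" by simp
  then have "real (covering_number (4 * \<rho>) E) \<le> card W * (real n + 1)"
    by (metis of_nat_mono of_nat_mult of_nat_add of_nat_1)
  also have "real n \<le> L / \<rho>"
    unfolding n_def using L \<rho>_pos by (intro of_nat_floor) auto
  finally show ?thesis by (simp add: mult_left_mono)
qed

text \<open>
  The points chosen below have abscissae \<open>2 \<alpha>\<^sup>k\<close> apart inside each cylinder, and cylinders of level \<open>k\<close>
  have ordinates \<open>\<alpha>\<^sup>k\<close> apart, so a set of diameter at most \<open>\<alpha>\<^sup>k\<close> contains at most five of them.
\<close>
lemma covering_number_lower:
  fixes L :: real
  assumes W: "W \<subseteq> words k" and L: "0 \<le> L" and "bounded E"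
    and a: "\<And>w. w \<in> W \<Longrightarrow> {a w..a w + L} \<subseteq> {pos \<beta> w..pos \<beta> w + \<beta> ^ k}"
    and E: "\<And>w z. w \<in> W \<Longrightarrow> z \<in> cyl w ` F \<Longrightarrow> fst z \<in> {a w..a w + L} \<Longrightarrow> z \<in> E"
  shows "card W * L \<le> 10 * \<alpha> ^ k * covering_number (\<alpha> ^ k) E"
proof -
  define \<rho> where "\<rho> = \<alpha> ^ k"
  have \<rho>: "0 < \<rho>" using \<alpha> by (simp add: \<rho>_def)
  obtain \<U> where U: "fine_cover \<rho> E \<U>" "card \<U> = covering_number \<rho> E"
    using covering_number_attained[OF \<open>bounded E\<close> \<rho>] by blast
  \<comment> \<open>This is the number of points with spacing \<open>2 * \<rho>\<close> in a window
    of length \<open>L\<close>, both ends allowed; hence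
    \<open>n \<ge> L / (2 * \<rho>)\<close>.\<close>
  define n where "n = nat \<lfloor>L / (2 * \<rho>)\<rfloor> + 1"
  have finW: "finite W" using W finite_words finite_subset by blast
  have "\<exists>z. z \<in> cyl w ` F \<and> fst z = a w + 2 * \<rho> * i" if "w \<in> W" "i < n" for w i
  proof -
    have "real i \<le> real (nat \<lfloor>L / (2 * \<rho>)\<rfloor>)" using that by (simp add: n_def)
    also have "\<dots> \<le> L / (2 * \<rho>)" using L \<rho> by (intro of_nat_floor) auto
    finally have "2 * \<rho> * i \<le> L" using \<rho> by (simp add: field_simps)
    then have "a w + 2 * \<rho> * i \<in> {a w..a w + L}" using \<rho> by auto
    then have "a w + 2 * \<rho> * i \<in> fst ` cyl w ` F"
      using fst_cyl_image[of w k] W a that by blast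
    then show ?thesis by force
  qed
  then obtain p where p: "\<And>w i. w \<in> W \<Longrightarrow> i < n \<Longrightarrow> p (w, i) \<in> cyl w ` F \<and> fst (p (w, i)) = a w + 2 * \<rho> * real i"
    by (metis old.prod.case split_conv)
  have pE: "p (w, i) \<in> E" if "w \<in> W" "i < n" for w i
  proof (rule E)
    show "fst (p (w, i)) \<in> {a w..a w + L}"
    proof -
      have "real i \<le> real (nat \<lfloor>L / (2 * \<rho>)\<rfloor>)" using that by (simp add: n_def)
      also have "\<dots> \<le> L / (2 * \<rho>)" using L \<rho> by (intro of_nat_floor) auto
      finally have "2 * \<rho> * i \<le> L" using \<rho> by (simp add: field_simps)
      then show ?thesis using p that \<rho> by auto
    qed
  qed (use p that in auto)
  define I where "I U = {q \<in> W \<times> {..<n}. p q \<in> U}" for U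
  have finI: "finite (I U)" for U
    unfolding I_def using finW by auto
  have cardI: "card (I U) \<le> 5" if "U \<in> \<U>" for U
  proof (cases "I U = {}")
    case False
    have "bounded U" "diameter U \<le> \<rho>" using U that by (auto simp: fine_cover_def)
    then have dU: "dist y z \<le> \<rho>" if "y \<in> U" "z \<in> U" for y z
      using diameter_bounded_bound[of U y z] that by simp
    have inj: "inj_on fst (I U)"
    proof (rule inj_onI)
      fix q q' assume q: "q \<in> I U" "q' \<in> I U" "fst q = fst q'"
      obtain w i i' where wi: "q = (w, i)" "q' = (w, i')" using q(3) by (metis prod.collapse)
      then have wI: "w \<in> W" "i < n" "i' < n" "p (w, i) \<in> U" "p (w, i') \<in> U"
        using q by (auto simp: I_def)
      have "\<bar>fst (p (w, i)) - fst (p (w, i'))\<bar> \<le> \<rho>"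
        using dist_fst_le[of "p (w, i)" "p (w, i')"] dU[OF wI(4,5)] by (simp add: dist_real_def)
      then have "2 * \<rho> * \<bar>real i - real i'\<bar> \<le> \<rho>"
        using p wI \<rho> by (simp add: abs_mult flip: right_diff_distrib)
      then have "\<bar>real i - real i'\<bar> \<le> 1/2" using \<rho> by simp
      then have "i = i'" by linarith
      then show "q = q'" using wi by simp
    qed
    obtain w0 i0 where w0: "(w0, i0) \<in> I U" using False by auto
    have y: "pos \<alpha> w \<in> {pos \<alpha> w0 - 2 * \<rho>..pos \<alpha> w0 - 2 * \<rho> + 4 * \<rho>}" if "(w, i) \<in> I U" for w i
    proof -
      have "\<bar>snd (p (w, i)) - snd (p (w0, i0))\<bar> \<le> \<rho>"
        using dist_snd_le[of "p (w, i)" "p (w0, i0)"] dU[of "p (w, i)" "p (w0, i0)"] that w0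
        by (simp add: dist_real_def I_def)
      moreover have "snd (p (v, j)) \<in> {pos \<alpha> v..pos \<alpha> v + \<rho>}" if vj: "(v, j) \<in> I U" for v j
      proof -
        have "v \<in> W" "p (v, j) \<in> cyl v ` F" using vj p by (auto simp: I_def)
        then show ?thesis using snd_cyl[of v k] W by (auto simp: \<rho>_def)
      qed
      note this[OF that] this[OF w0]
      ultimately show ?thesis by auto
    qed
    \<comment> \<open>Ordinates in \<open>U\<close> differ by at most \<open>\<rho>\<close> and each
      exceeds the position of its word by at most \<open>\<rho>\<close>, so the positions lie within
      \<open>2 * \<rho>\<close> of that of \<open>w0\<close>; their separation is where
      \<open>\<alpha> \<le> 1/2\<close> is used.\<close>
    have "real (card (fst ` I U)) \<le> 4 * \<rho> / \<rho> + 1"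
    proof (rule card_separated_le[where y = "pos \<alpha>"])
      fix v w assume "v \<in> fst ` I U" "w \<in> fst ` I U" "v \<noteq> w"
      then show "\<rho> \<le> \<bar>pos \<alpha> v - pos \<alpha> w\<bar>"
        unfolding \<rho>_def using \<alpha> W by (intro pos_separation) (auto simp: I_def)
    next
      fix v assume "v \<in> fst ` I U"
      then show "pos \<alpha> v \<in> {pos \<alpha> w0 - 2 * \<rho>..pos \<alpha> w0 - 2 * \<rho> + 4 * \<rho>}"
        using y by force
    qed (use \<rho> in auto)
    then show ?thesis using \<rho> card_image[OF inj] by simp
  qed simp
  have "W \<times> {..<n} \<subseteq> (\<Union>U\<in>\<U>. I U)"
  proof
    fix q assume q: "q \<in> W \<times> {..<n}"
    then have "p q \<in> E" using pE by auto
    then obtain U where "U \<in> \<U>" "p q \<in> U" using U(1) by (auto simp: fine_cover_def)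
    with q show "q \<in> (\<Union>U\<in>\<U>. I U)" by (auto simp: I_def)
  qed
  moreover have "finite \<U>" using U by (simp add: fine_cover_def)
  ultimately have "card (W \<times> {..<n}) \<le> card (\<Union>U\<in>\<U>. I U)"
    using finI by (intro card_mono) auto
  also have "\<dots> \<le> (\<Sum>U\<in>\<U>. card (I U))" using \<open>finite \<U>\<close> by (rule card_UN_le)
  also have "\<dots> \<le> (\<Sum>U\<in>\<U>. 5)" using cardI by (rule sum_mono)
  also have "\<dots> = 5 * covering_number \<rho> E" using U by simp
  finally have "card W * n \<le> 5 * covering_number \<rho> E"
    by (simp add: card_cartesian_product)
  then have *: "real (card W) * n \<le> 5 * covering_number \<rho> E"
    by (metis of_nat_mono of_nat_mult of_nat_numeral)
  have "L / (2 * \<rho>) \<le> n"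
    unfolding n_def by linarith
  then have "card W * (L / (2 * \<rho>)) \<le> 5 * covering_number \<rho> E"
    using * by (meson mult_left_mono of_nat_0_le_iff order_trans)
  then show ?thesis
    using \<rho> unfolding \<rho>_def[symmetric] by (simp add: field_simps)
qed

end

section \<open>Box dimension and the upper Assouad bound\<close>

lemma frostman_window:
  assumes "0 < \<beta>" "\<beta> < 1" "t \<in> frostman_set \<beta>" "0 \<le> t"
  obtains C where "0 < C" "\<And>a l. 0 < l \<Longrightarrow> measure (bernoulli_conv \<beta>) {a..a + l} \<le> C * l powr t"
proof -
  interpret self_similar_prob \<beta> "bernoulli_conv \<beta>"
    using self_similar_bernoulli_conv assms by blast
  obtain C where C: "C > 0" "\<And>I. is_interval I \<and> I \<subseteq> {0..1} \<Longrightarrow>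
      measure (bernoulli_conv \<beta>) I \<le> C * measure lborel I powr t"
    using assms by (auto simp: frostman_set_def)
  have "measure (bernoulli_conv \<beta>) {a..a + l} \<le> C * l powr t" if "0 < l" for a l
  proof -
    let ?I = "{max a 0..min (a + l) 1}"
    have "measure (bernoulli_conv \<beta>) {a..a + l} \<le> measure (bernoulli_conv \<beta>) ?I"
      by (intro measure_le_unit) auto
    also have "\<dots> \<le> C * measure lborel ?I powr t"
      by (intro C) (auto simp: is_interval_cc)
    also have "\<dots> \<le> C * l powr t"
      using C(1) that assms(4) by (intro mult_left_mono powr_mono2) (auto simp: max_def min_def)
    finally show ?thesis .
  qed
  with C(1) show ?thesis using that by blast
qed

context carpet
begin

sublocale \<nu>: self_similar_prob \<beta> "bernoulli_conv \<beta>"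
  using self_similar_bernoulli_conv \<beta>_pos \<beta> by blast

text \<open>The logarithm to base \<open>1 / \<alpha>\<close>: it turns growth by a factor
  \<open>x\<close> per level into an exponent of the scale.\<close>

definition expo :: "real \<Rightarrow> real" where
  "expo x = ln x / (- ln \<alpha>)"

lemma ln_\<alpha>: "ln \<alpha> < 0"
  using \<alpha> by simp

lemma expo_powr: "0 < x \<Longrightarrow> (1 / \<alpha> ^ k) powr expo x = x ^ k"
proof -
  assume x: "0 < x"
  have "(1 / \<alpha> ^ k) powr expo x = exp (expo x * ln (1 / \<alpha> ^ k))"
    using \<alpha> by (simp add: powr_def)
  also have "expo x * ln (1 / \<alpha> ^ k) = k * ln x"
    using \<alpha> ln_\<alpha> by (simp add: expo_def ln_div ln_realpow)
  also have "exp (k * ln x) = x ^ k"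
    using x by (simp add: exp_of_nat_mult)
  finally show ?thesis .
qed

lemma expo_powr_Suc: "0 < x \<Longrightarrow> (1 / \<alpha> ^ k) powr (1 + expo x) = (x / \<alpha>) ^ k"
  using \<alpha> by (simp add: powr_add expo_powr power_divide)

lemma expo_nonneg: "1 \<le> x \<Longrightarrow> 0 \<le> expo x"
  using ln_\<alpha> unfolding expo_def by (intro divide_nonneg_pos) auto

text \<open>Each of the 2^N cylinders has width \<open>\<beta> ^ N\<close> and height
  \<open>\<alpha> ^ N\<close>, hence needs about \<open>(\<beta> / \<alpha>) ^ N\<close> squares of
  side \<open>\<alpha> ^ N\<close>, and vertical separation makes this count sharp up to
  constants.\<close>

lemma box_dim_F: "box_dim F = 1 + expo (2 * \<beta>)"
proof (rule box_dim_eqI)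
  define d where "d = 1 + expo (2 * \<beta>)"
  have d: "0 \<le> d" using expo_nonneg[of "2 * \<beta>"] \<beta> by (simp add: d_def)
  have d_power: "(1 / \<alpha> ^ k) powr d = (2 * \<beta> / \<alpha>) ^ k" for k
    unfolding d_def using \<beta> by (intro expo_powr_Suc) auto
  fix r :: real assume r: "0 < r" "r < 1"
  show "covering_number r F \<le> (2 * (4 / \<alpha>) powr d) * r powr - (1 + expo (2 * \<beta>))"
  proof -
    define \<rho> where "\<rho> = r / 4"
    obtain j where j: "\<alpha> ^ Suc j < \<rho>" "\<rho> \<le> \<alpha> ^ j"
      using exists_power_bracket[of \<alpha> \<rho>] \<alpha> r by (auto simp: \<rho>_def)
    define N where "N = Suc j"
    have "real (covering_number (4 * \<rho>) F) \<le> card (words N) * (\<beta> ^ N / \<rho> + 1)"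
    proof (rule covering_number_upper[where a = "pos \<beta>"])
      show "F \<subseteq> (\<Union>w\<in>words N. cyl w ` F)"
        using F_eq_cyl by (rule equalityD1)
      show "fst z \<in> {pos \<beta> w..pos \<beta> w + \<beta> ^ N}" if "w \<in> words N" "z \<in> cyl w ` F" for w z
        using fst_cyl_image[OF that(1)] that(2) by blast
    qed (use j \<beta> in \<open>auto simp: N_def\<close>)
    also have "\<dots> \<le> 2 ^ N * (\<beta> ^ N / \<alpha> ^ N + \<beta> ^ N / \<alpha> ^ N)"
    proof -
      have "\<beta> ^ N / \<rho> \<le> \<beta> ^ N / \<alpha> ^ N"
        using j r \<alpha> \<beta> by (intro divide_left_mono) (auto simp: N_def \<rho>_def)
      moreover have "1 \<le> \<beta> ^ N / \<alpha> ^ N"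
        using \<alpha> \<beta> by (simp add: power_mono)
      ultimately show ?thesis
        unfolding card_words of_nat_power of_nat_numeral by (intro mult_left_mono add_mono) auto
    qed
    also have "\<dots> = 2 * (1 / \<alpha> ^ N) powr d"
      by (simp add: d_power power_divide power_mult_distrib)
    also have "\<dots> \<le> 2 * (4 / \<alpha> * (1 / r)) powr d"
    proof -
      have "1 / \<alpha> ^ N \<le> 4 / \<alpha> * (1 / r)"
        using j \<alpha> r by (simp add: N_def \<rho>_def field_simps)
      then show ?thesis using d \<alpha> by (intro mult_left_mono powr_mono2) auto
    qed
    also have "(4 / \<alpha> * (1 / r)) powr d = (4 / \<alpha>) powr d * r powr - d"
      using \<alpha> r by (subst powr_mult) (auto simp: powr_minus powr_divide field_simps)
    finally show ?thesis by (simp add: \<rho>_def d_def mult_ac)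
  qed
  show "(\<alpha> powr d / 10) * r powr - (1 + expo (2 * \<beta>)) \<le> covering_number r F"
  proof -
    obtain N where N: "\<alpha> ^ Suc N < r" "r \<le> \<alpha> ^ N"
      using exists_power_bracket[of \<alpha> r] \<alpha> r by auto
    have "card (words N) * \<beta> ^ N \<le> 10 * \<alpha> ^ N * covering_number (\<alpha> ^ N) F"
      by (rule covering_number_lower[where a = "pos \<beta>"]) (use \<beta> bounded_F cyl_in_F in auto)
    then have "(2 * \<beta> / \<alpha>) ^ N / 10 \<le> covering_number (\<alpha> ^ N) F"
      using \<alpha> by (simp add: power_mult_distrib power_divide field_simps)
    also have "covering_number (\<alpha> ^ N) F \<le> covering_number r F"
      using N r bounded_F by (intro covering_number_mono) auto
    finally have *: "(1 / \<alpha> ^ N) powr d / 10 \<le> covering_number r F"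
      by (simp add: d_power)
    have "\<alpha> / r \<le> 1 / \<alpha> ^ N"
      using N r \<alpha> by (simp add: field_simps)
    then have "(\<alpha> / r) powr d \<le> (1 / \<alpha> ^ N) powr d"
      using d \<alpha> r by (intro powr_mono2) auto
    also have "(\<alpha> / r) powr d = \<alpha> powr d * r powr - d"
      using \<alpha> r by (simp add: powr_divide powr_minus field_simps)
    finally show ?thesis using * by (simp add: d_def)
  qed
qed (use \<alpha> in auto)

text \<open>Let \<open>\<alpha> ^ m\<close> be comparable to \<open>R\<close> and
  \<open>\<alpha> ^ N\<close> to \<open>r\<close>, and split words of length \<open>N\<close> as
  \<open>v @ w\<close> with \<open>v\<close> of length \<open>m\<close>. The ordinate leaves
  boundedly many \<open>v\<close>; the abscissa restricts \<open>w\<close> to a window whose mass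
  the Frostman condition controls. The bounds on \<open>r\<close> and \<open>R\<close> allow both
  scales to be bracketed by nonnegative powers of \<open>\<alpha>\<close>.\<close>

lemma assouad_upper_aux:
  assumes t: "t \<in> frostman_set \<beta>" "0 \<le> t"
  shows "\<exists>C>0. \<forall>(r::real) (R::real). 0 < r \<and> r < R \<and> r \<le> 1 \<and> R \<le> 2 \<longrightarrow>
     (\<forall>z\<in>F. real (covering_number r (ball z R \<inter> F)) \<le> C * (R / r) powr (1 + expo (2 * \<beta> powr t)))"
proof -
  have t1: "t \<le> 1" using t frostman_set_le_1 \<beta>_pos \<beta> by blast
  define \<tau> where "\<tau> = expo (2 * \<beta> powr t)"
  have "\<beta> powr 1 \<le> \<beta> powr t" using \<beta> t1 by (intro powr_mono') auto
  then have \<beta>t: "1 \<le> 2 * \<beta> powr t" using \<beta> by simp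
  have \<tau>: "0 \<le> \<tau>" unfolding \<tau>_def using \<beta>t by (rule expo_nonneg)
  obtain C where C: "0 < C" "\<And>a l. 0 < l \<Longrightarrow> measure (bernoulli_conv \<beta>) {a..a + l} \<le> C * l powr t"
    using frostman_window[OF \<beta>_pos \<beta>(2) t] by blast
  \<comment> \<open>The brackets give \<open>\<alpha> ^ m < R / (2 * \<alpha>)\<close> and
    \<open>1 / \<alpha> ^ N \<le> 4 / (\<alpha> * r)\<close>; their product bounds
    \<open>1 / \<alpha> ^ k\<close> by \<open>c * R / r\<close>.\<close>
  define c where "c = 2 / \<alpha>\<^sup>2"
  have c: "0 < c" using \<alpha> by (simp add: c_def)
  show ?thesis
  proof (intro exI[of _ "6 * C * (32 * c powr \<tau> + 6 * c)"] conjI allI impI ballI)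
    show "0 < 6 * C * (32 * c powr \<tau> + 6 * c)"
      using C c by (intro mult_pos_pos add_pos_pos) auto
  next
    fix r R :: real and z assume rR: "0 < r \<and> r < R \<and> r \<le> 1 \<and> R \<le> 2" and z: "z \<in> F"
    obtain x y where xy: "z = (x, y)" by (cases z)
    define \<rho> where "\<rho> = r / 4"
    obtain j where j: "\<alpha> ^ Suc j < \<rho>" "\<rho> \<le> \<alpha> ^ j"
      using exists_power_bracket[of \<alpha> \<rho>] \<alpha> rR by (auto simp: \<rho>_def)
    obtain m where m: "\<alpha> ^ Suc m < R / 2" "R / 2 \<le> \<alpha> ^ m"
      using exists_power_bracket[of \<alpha> "R / 2"] \<alpha> rR by auto
    have "\<alpha> ^ Suc j < \<alpha> ^ m" using j m rR by (simp add: \<rho>_def)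
    then have "m < Suc j" using \<alpha> power_decreasing[of "Suc j" m \<alpha>] by (intro not_le_imp_less notI) auto
    define k where "k = Suc j - m"
    define N where "N = m + k"
    have N: "N = Suc j" using \<open>m < Suc j\<close> by (simp add: N_def k_def)
    have \<rho>_pos: "0 < \<rho>" using rR by (simp add: \<rho>_def)
    define E where "E = ball z R \<inter> F"
    define W where "W = {u \<in> words N. cyl u ` F \<inter> ball z R \<noteq> {}}"
    define V where "V = {v \<in> words m. pos \<alpha> v \<in> {y - R - \<alpha> ^ m..y - R - \<alpha> ^ m + (2 * R + \<alpha> ^ m)}}"
    define Wv where "Wv v = {w \<in> words k. pos \<beta> (v @ w) \<in> {x - R - \<beta> ^ N..x + R}}" for v
    have pw: "0 < \<alpha> ^ m" "0 < \<beta> ^ m" "0 < \<beta> ^ k" "0 < \<beta> ^ N" "0 < \<alpha> ^ k" using \<alpha> \<beta>_pos by auto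
    \<comment> \<open>Inside the cylinder of \<open>v\<close>, rescaled to unit width,
      \<open>A\<close> is the radius of the ball and \<open>B\<close> the width of the intervals of
      \<open>w\<close>. Words whose interval meets the ball have their intervals in a window of
      length \<open>2 * A + 2 * B\<close>.\<close>
    define A where "A = R / \<beta> ^ m"
    define B where "B = \<beta> ^ k"
    have "\<alpha> ^ m \<le> \<beta> ^ m" using \<alpha> \<beta> by (intro power_mono) auto
    then have A: "0 < A" "A \<le> 2" using rR m pw by (auto simp: A_def field_simps)
    have B: "0 < B" "B \<le> 1" using \<beta> by (auto simp: B_def power_le_one)
    define l where "l = 2 * A + 2 * B"
    have W_sub: "W \<subseteq> (\<Union>v\<in>V. (\<lambda>w. v @ w) ` Wv v)"
    proof
      fix u assume u: "u \<in> W"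
      then obtain q where q: "q \<in> F" "cyl u q \<in> ball z R" "u \<in> words N" by (auto simp: W_def)
      define v w where "v = take m u" and "w = drop m u"
      have uvw: "u = v @ w" "v \<in> words m" "w \<in> words k"
        using q(3) by (auto simp: v_def w_def words_def N_def)
      have fs: "\<bar>x - fst (cyl u q)\<bar> < R" "\<bar>y - snd (cyl u q)\<bar> < R"
        using q(2) dist_fst_le[of z "cyl u q"] dist_snd_le[of z "cyl u q"] by (auto simp: xy dist_real_def)
      have "fst (cyl u q) \<in> {pos \<beta> u..pos \<beta> u + \<beta> ^ N}"
        using fst_cyl_image[OF q(3)] q(1) by blast
      then have 1: "w \<in> Wv v" using fs uvw by (auto simp: Wv_def)
      have "0 \<le> pos \<alpha> w" "pos \<alpha> w \<le> 1 - \<alpha> ^ k"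
        using pos_bounds[of \<alpha> w] \<alpha> uvw by (auto simp: words_def)
      then have "0 \<le> \<alpha> ^ m * pos \<alpha> w" "\<alpha> ^ m * pos \<alpha> w \<le> \<alpha> ^ m * (1 - \<alpha> ^ k)"
        using pw by (auto intro: mult_left_mono)
      moreover have "pos \<alpha> u = pos \<alpha> v + \<alpha> ^ m * pos \<alpha> w"
        using uvw by (simp add: pos_append words_def)
      moreover have "snd (cyl u q) \<in> {pos \<alpha> u..pos \<alpha> u + \<alpha> ^ N}"
        using snd_cyl[OF q(3,1)] .
      ultimately have "snd (cyl u q) \<in> {pos \<alpha> v..pos \<alpha> v + \<alpha> ^ m}"
        by (auto simp: N_def power_add algebra_simps)
      then have "v \<in> V" using fs uvw by (auto simp: V_def)
      with 1 show "u \<in> (\<Union>v\<in>V. (\<lambda>w. v @ w) ` Wv v)" using uvw by blast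
    qed
    have cardV: "real (card V) \<le> 6"
    proof -
      have "real (card V) \<le> (2 * R + \<alpha> ^ m) / \<alpha> ^ m + 1"
      proof (rule card_separated_le[where y = "pos \<alpha>"])
        show "\<alpha> ^ m \<le> \<bar>pos \<alpha> v - pos \<alpha> w\<bar>" if "v \<in> V" "w \<in> V" "v \<noteq> w" for v w
          using that \<alpha> by (intro pos_separation) (auto simp: V_def)
      qed (use pw rR in \<open>auto simp: V_def\<close>)
      also have "\<dots> \<le> (5 * \<alpha> ^ m) / \<alpha> ^ m + 1"
        using m pw by (intro add_right_mono divide_right_mono) auto
      also have "\<dots> = 6" using \<alpha>(1) by simp
      finally show ?thesis .
    qed
    have cardWv: "real (card (Wv v)) \<le> 2 ^ k * (C * l powr t)" if "v \<in> V" for v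
    proof -
      have lv: "length v = m" using that by (simp add: V_def words_def)
      define a where "a = (x - R - \<beta> ^ N - pos \<beta> v) / \<beta> ^ m"
      have al: "a + l = (x + R - pos \<beta> v) / \<beta> ^ m + \<beta> ^ k"
        using \<beta>_pos by (simp add: a_def l_def A_def B_def N_def power_add add_divide_distrib diff_divide_distrib)
      have "real (card (Wv v)) \<le> 2 ^ k * measure (bernoulli_conv \<beta>) {a..a + l}"
      proof (rule \<nu>.card_words_le_measure)
        fix w assume w: "w \<in> Wv v"
        then have "x - R - \<beta> ^ N \<le> pos \<beta> v + \<beta> ^ m * pos \<beta> w" "pos \<beta> v + \<beta> ^ m * pos \<beta> w \<le> x + R"
          by (auto simp: Wv_def pos_append lv)
        then have "a \<le> pos \<beta> w" "pos \<beta> w \<le> (x + R - pos \<beta> v) / \<beta> ^ m"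
          using pw by (simp_all add: a_def pos_divide_le_eq pos_le_divide_eq algebra_simps)
        then show "{pos \<beta> w..pos \<beta> w + \<beta> ^ k} \<inter> {0..1} \<subseteq> {a..a + l}"
          unfolding al by auto
      qed (auto simp: Wv_def)
      also have "\<dots> \<le> 2 ^ k * (C * l powr t)"
        using A B by (intro mult_left_mono C) (auto simp: l_def)
      finally show ?thesis .
    qed
    have finV: "finite V" by (simp add: V_def)
    have "card W \<le> card (\<Union>v\<in>V. (\<lambda>w. v @ w) ` Wv v)"
      using finV by (intro card_mono[OF _ W_sub]) (auto simp: Wv_def)
    also have "\<dots> \<le> (\<Sum>v\<in>V. card ((\<lambda>w. v @ w) ` Wv v))"
      using finV by (rule card_UN_le)
    also have "\<dots> \<le> (\<Sum>v\<in>V. card (Wv v))"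
      by (intro sum_mono card_image_le) (simp add: Wv_def)
    finally have "real (card W) \<le> (\<Sum>v\<in>V. real (card (Wv v)))"
      by (metis of_nat_mono of_nat_sum)
    also have "\<dots> \<le> (\<Sum>v\<in>V. 2 ^ k * (C * l powr t))"
      by (intro sum_mono cardWv)
    also have "\<dots> = card V * (2 ^ k * (C * l powr t))" by simp
    also have "\<dots> \<le> 6 * (2 ^ k * (C * l powr t))"
      using cardV C by (intro mult_right_mono) auto
    finally have cardW: "real (card W) \<le> 6 * (2 ^ k * (C * l powr t))" .
    define L where "L = min (2 * R) (\<beta> ^ N)"
    have L: "0 < L" using rR pw by (simp add: L_def)
    have cov: "real (covering_number r E) \<le> card W * (L / \<rho> + 1)"
    proof -
      have "real (covering_number (4 * \<rho>) E) \<le> card W * (L / \<rho> + 1)"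
      proof (rule covering_number_upper[where N = N and a = "\<lambda>w. max (x - R) (pos \<beta> w)"])
        show "E \<subseteq> (\<Union>w\<in>W. cyl w ` F)"
          using equalityD1[OF F_eq_cyl[of N]] unfolding E_def W_def by blast
      next
        fix w q assume q: "w \<in> W" "q \<in> E" "q \<in> cyl w ` F"
        have "fst q \<in> {pos \<beta> w..pos \<beta> w + \<beta> ^ N}"
          using fst_cyl_image[of w N] q by (auto simp: W_def)
        moreover have "\<bar>x - fst q\<bar> < R"
          using q(2) dist_fst_le[of z q] by (auto simp: E_def xy dist_real_def)
        ultimately show "fst q \<in> {max (x - R) (pos \<beta> w)..max (x - R) (pos \<beta> w) + L}"
          by (auto simp: L_def)
      qed (use j L in \<open>auto simp: W_def N\<close>)
      then show ?thesis by (simp add: \<rho>_def)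
    qed
    have lt: "l powr t \<le> 6"
    proof -
      have "l powr t \<le> 6 powr t" using A B t by (intro powr_mono2) (auto simp: l_def)
      also have "\<dots> \<le> 6 powr 1" using t1 by (intro powr_mono) auto
      finally show ?thesis by simp
    qed
    have four: "(4 * s) powr t \<le> 4 * s powr t" if "0 < s" for s :: real
    proof -
      have "(4 :: real) powr t \<le> 4 powr 1" using t1 by (intro powr_mono) auto
      then show ?thesis using that by (simp add: powr_mult mult_right_mono)
    qed
    have R_eq: "R = \<beta> ^ m * A" using \<beta>_pos by (simp add: A_def)
    \<comment> \<open>The wider of ball and interval determines the mass, the narrower one the
      length to be covered. If the ball is the wider, \<open>t \<le> 1\<close> is what allows
      \<open>A powr t * B\<close> to be exchanged for \<open>A * B powr t\<close>.\<close>
    have lL: "l powr t * L \<le> 8 * R * B powr t"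
    proof (cases "A \<le> B")
      case True
      have "l powr t \<le> (4 * B) powr t" using True A B t by (intro powr_mono2) (auto simp: l_def)
      also have "\<dots> \<le> 4 * B powr t" using four B by simp
      finally have "l powr t * L \<le> (4 * B powr t) * (2 * R)"
        using L by (intro mult_mono) (auto simp: L_def)
      then show ?thesis by (simp add: mult_ac)
    next
      case False
      have "l powr t \<le> (4 * A) powr t" using False A B t by (intro powr_mono2) (auto simp: l_def)
      also have "\<dots> \<le> 4 * A powr t" using four A by simp
      finally have "l powr t * L \<le> (4 * A powr t) * (\<beta> ^ m * B)"
        using L by (intro mult_mono) (auto simp: L_def N_def B_def power_add)
      also have "\<dots> = 4 * \<beta> ^ m * (A powr t * B powr t * B powr (1 - t))"
        using B by (simp add: powr_diff)
      also have "\<dots> \<le> 4 * \<beta> ^ m * (A powr t * B powr t * A powr (1 - t))"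
        using False B pw t1 by (intro mult_left_mono powr_mono2) auto
      also have "\<dots> = 4 * R * B powr t"
        using A by (simp add: powr_diff R_eq)
      also have "\<dots> \<le> 8 * R * B powr t"
        using rR by (intro mult_right_mono) auto
      finally show ?thesis .
    qed
    define Q where "Q = R / r"
    have Q: "1 < Q" using rR by (simp add: Q_def)
    have \<alpha>k: "1 / \<alpha> ^ k \<le> c * Q"
    proof -
      have "\<alpha> * (r / 4) \<le> \<alpha> ^ N" using j \<alpha> unfolding N \<rho>_def by simp
      moreover have "\<alpha> * \<alpha> ^ m * 2 \<le> R" using m by simp
      ultimately have "(\<alpha> * \<alpha> ^ m * 2) * (\<alpha> * (r / 4)) \<le> R * \<alpha> ^ N"
        using \<alpha> rR by (intro mult_mono) auto
      then have "\<alpha> ^ m * (\<alpha>\<^sup>2 * r) \<le> \<alpha> ^ m * (2 * R * \<alpha> ^ k)"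
        by (simp add: N_def power_add power2_eq_square mult_ac)
      then have "\<alpha>\<^sup>2 * r \<le> 2 * R * \<alpha> ^ k"
        using pw(1) by (simp only: mult_le_cancel_left_pos)
      then show ?thesis using \<alpha> rR pw by (simp add: c_def Q_def field_simps)
    qed
    \<comment> \<open>The \<open>+ 1\<close> in the number of balls per cylinder leaves a term of
      order 2^k, absorbed because \<open>2 \<le> 1 / \<alpha>\<close> and
      \<open>\<tau> \<ge> 0\<close>.\<close>
    have two_k: "2 ^ k \<le> c * Q powr (1 + \<tau>)"
    proof -
      have "2 ^ k \<le> (1 / \<alpha>) ^ k" using \<alpha> by (intro power_mono) (auto simp: field_simps)
      also have "\<dots> \<le> c * Q" using \<alpha>k by (simp add: power_divide)
      also have "Q \<le> Q powr (1 + \<tau>)" using Q \<tau> powr_mono[of 1 "1 + \<tau>" Q] by simp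
      finally show ?thesis using c by simp
    qed
    have beta_k: "2 ^ k * B powr t \<le> c powr \<tau> * Q powr \<tau>"
    proof -
      have "B powr t = (\<beta> powr t) ^ k"
        unfolding B_def using \<beta>_pos by (simp add: powr_powr mult.commute flip: powr_realpow)
      then have "2 ^ k * B powr t = (2 * \<beta> powr t) ^ k"
        by (simp add: power_mult_distrib)
      also have "\<dots> = (1 / \<alpha> ^ k) powr \<tau>"
        unfolding \<tau>_def using \<beta>_pos by (intro expo_powr[symmetric]) auto
      also have "\<dots> \<le> (c * Q) powr \<tau>"
        using \<alpha>k pw \<tau> by (intro powr_mono2) auto
      finally show ?thesis using c Q by (simp add: powr_mult)
    qed
    have "real (covering_number r E) \<le> 6 * (2 ^ k * (C * l powr t)) * (L / \<rho> + 1)"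
      using cov cardW L \<rho>_pos by (meson mult_right_mono order_trans add_nonneg_nonneg divide_nonneg_pos less_imp_le zero_le_one)
    also have "\<dots> = 6 * C * (2 ^ k * (l powr t * L) / \<rho> + 2 ^ k * l powr t)"
      using \<rho>_pos by (simp add: field_simps)
    also have "\<dots> \<le> 6 * C * (2 ^ k * (8 * R * B powr t) / \<rho> + 2 ^ k * 6)"
      using lL lt C \<rho>_pos by (intro mult_left_mono add_mono divide_right_mono) auto
    also have "\<dots> = 6 * C * (32 * (2 ^ k * B powr t) * Q + 6 * 2 ^ k)"
      using rR by (simp add: \<rho>_def Q_def field_simps)
    also have "\<dots> \<le> 6 * C * (32 * (c powr \<tau> * Q powr \<tau>) * Q + 6 * (c * Q powr (1 + \<tau>)))"
      using beta_k two_k C Q by (intro mult_left_mono add_mono mult_right_mono) auto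
    also have "\<dots> = 6 * C * (32 * c powr \<tau> + 6 * c) * Q powr (1 + \<tau>)"
      using Q by (simp add: powr_add algebra_simps)
    finally show "real (covering_number r (ball z R \<inter> F))
        \<le> 6 * C * (32 * c powr \<tau> + 6 * c) * (R / r) powr (1 + expo (2 * \<beta> powr t))"
      by (simp add: E_def Q_def \<tau>_def)
  qed
qed

end

section \<open>The Assouad dimension\<close>

definition assouad_set :: "'a::euclidean_space set \<Rightarrow> real set" where
  "assouad_set E = {u. \<exists>C>0. \<forall>r R. 0 < r \<and> r < R \<longrightarrow>
            (\<forall>x\<in>E. real (covering_number r (ball x R \<inter> E)) \<le> C * (R / r) powr u)}"

lemma assouad_dim_eq: "assouad_dim E = Inf (assouad_set E)"
  by (simp add: assouad_dim_def assouad_set_def)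

text \<open>Any element of the Frostman set, whatever its sign, excludes atoms in [0,1], because
  \<open>0 powr t = 0\<close>.\<close>

lemma bernoulli_singleton:
  assumes "0 < \<beta>" "\<beta> < 1"
  shows "measure (bernoulli_conv \<beta>) {a} = 0"
proof -
  interpret self_similar_prob \<beta> "bernoulli_conv \<beta>"
    using self_similar_bernoulli_conv assms by blast
  obtain t where "t \<in> frostman_set \<beta>"
    using frostman_set_nonempty assms by blast
  then obtain C where C: "\<And>I. is_interval I \<and> I \<subseteq> {0..1} \<Longrightarrow>
      measure (bernoulli_conv \<beta>) I \<le> C * measure lborel I powr t"
    by (auto simp: frostman_set_def)
  show ?thesis
  proof (cases "a \<in> {0..1}")
    case True
    moreover have "is_interval {a}" using is_interval_cc[of a a] by simp
    ultimately show ?thesis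
      using C[of "{a}"] measure_nonneg[of "bernoulli_conv \<beta>" "{a}"] by simp
  next
    case False
    then show ?thesis by (intro measure_eq_0) auto
  qed
qed

context carpet
begin

text \<open>The attractor lies in every ball of radius 2 about one of its points, so
  \<open>R\<close> may be cut at 2; cutting \<open>r\<close> at 1 only refines the cover. Together
  the cuts raise the ratio \<open>R / r\<close> by at most a factor 2.\<close>

lemma assouad_set_upper:
  assumes t: "t \<in> frostman_set \<beta>" "0 \<le> t"
  shows "1 + expo (2 * \<beta> powr t) \<in> assouad_set F"
proof -
  define u where "u = 1 + expo (2 * \<beta> powr t)"
  have "t \<le> 1" using t frostman_set_le_1 \<beta>_pos \<beta> by blast
  then have "\<beta> powr 1 \<le> \<beta> powr t" using \<beta> by (intro powr_mono') auto
  then have u: "0 \<le> u" using expo_nonneg[of "2 * \<beta> powr t"] \<beta> by (simp add: u_def)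
  obtain C where C: "0 < C" "\<And>r R z. 0 < r \<Longrightarrow> r < R \<Longrightarrow> r \<le> 1 \<Longrightarrow> R \<le> 2 \<Longrightarrow> z \<in> F \<Longrightarrow>
      real (covering_number r (ball z R \<inter> F)) \<le> C * (R / r) powr u"
    using assouad_upper_aux[OF t] unfolding u_def by blast
  have "real (covering_number r (ball z R \<inter> F)) \<le> (C * 2 powr u) * (R / r) powr u"
    if rR: "0 < r" "r < R" and z: "z \<in> F" for r R z
  proof -
    define r' R' where "r' = min r 1" and "R' = min R 2"
    have r': "0 < r'" "r' < R'" "r' \<le> 1" "R' \<le> 2" "r' \<le> r"
      using rR by (auto simp: r'_def R'_def)
    have "F \<subseteq> ball z 2"
    proof
      fix q assume "q \<in> F"
      show "q \<in> ball z 2"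
      proof -
        obtain a b a' b' where ab: "z = (a, b)" "q = (a', b')" by (cases z; cases q)
        then have b01: "0 \<le> a" "a \<le> 1" "0 \<le> b" "b \<le> 1" "0 \<le> a'" "a' \<le> 1" "0 \<le> b'" "b' \<le> 1"
          using F_subset_square z \<open>q \<in> F\<close> by auto
        then have "\<bar>a - a'\<bar>\<^sup>2 \<le> 1\<^sup>2" "\<bar>b - b'\<bar>\<^sup>2 \<le> 1\<^sup>2"
          by (intro power_mono; linarith)+
        then have "(a - a')\<^sup>2 + (b - b')\<^sup>2 < 2\<^sup>2" by simp
        then have "sqrt ((a - a')\<^sup>2 + (b - b')\<^sup>2) < 2" by (intro real_less_lsqrt) auto
        then show ?thesis by (simp add: ab dist_Pair_Pair dist_real_def)
      qed
    qed
    then have "ball z R \<inter> F \<subseteq> ball z R' \<inter> F" by (auto simp: R'_def)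
    then have "covering_number r (ball z R \<inter> F) \<le> covering_number r' (ball z R' \<inter> F)"
      using r' bounded_F by (intro covering_number_mono) (auto intro: bounded_subset)
    then have "real (covering_number r (ball z R \<inter> F)) \<le> C * (R' / r') powr u"
      using C(2)[OF r'(1-4) z] by linarith
    also have "(R' / r') powr u \<le> (2 * (R / r)) powr u"
    proof (rule powr_mono2[OF u])
      show "R' / r' \<le> 2 * (R / r)"
        using rR by (auto simp: r'_def R'_def min_def field_simps)
    qed (use r' in auto)
    also have "(2 * (R / r)) powr u = 2 powr u * (R / r) powr u"
      by (rule powr_mult)
    finally show ?thesis using C(1) by (simp add: mult_ac mult_left_mono)
  qed
  moreover have "0 < C * 2 powr u" using C(1) by simp
  ultimately show ?thesis
    unfolding assouad_set_def u_def by blast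
qed

text \<open>
  A thin vertical strip crossing all the cylinders counted here is blown down by \<open>S\<^sub>1\<close> until its
  width \<open>\<alpha>\<^sup>m\<close> equals its height; covering the resulting square-shaped piece is then controlled by the
  Assouad condition.
\<close>
lemma card_words_window_le:
  assumes C: "\<And>r R z. 0 < r \<Longrightarrow> r < R \<Longrightarrow> z \<in> F \<Longrightarrow>
      real (covering_number r (ball z R \<inter> F)) \<le> C * (R / r) powr u"
    and "0 < C"
  shows "card {w \<in> words k. pos \<beta> w \<in> {c..c + \<beta> ^ k / 2}} \<le> 10 * C * 3 powr u * \<alpha> ^ k * (1 / \<alpha> ^ k) powr u"
proof -
  define W where "W = {w \<in> words k. pos \<beta> w \<in> {c..c + \<beta> ^ k / 2}}"
  \<comment> \<open>Since \<open>\<alpha> < \<beta>\<close>, for large \<open>m\<close> the strip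
    width \<open>\<alpha> ^ m\<close> is at most half the width of an interval of level
    \<open>m + k\<close>.\<close>
  have "0 < \<alpha> / \<beta>" "\<alpha> / \<beta> < 1" "0 < \<beta> ^ k / 2" using \<alpha> \<beta> by auto
  then obtain m where "(\<alpha> / \<beta>) ^ m < \<beta> ^ k / 2"
    using real_arch_pow_inv by blast
  then have m: "\<alpha> ^ m \<le> \<beta> ^ m * (\<beta> ^ k / 2)"
    using \<beta>_pos by (simp add: power_divide field_simps)
  have pw: "0 < \<alpha> ^ m" "0 < \<beta> ^ m" "0 < \<alpha> ^ k" using \<alpha> \<beta>_pos by auto
  define v where "v = replicate m False"
  \<comment> \<open>The scaled right end of the window: every interval of width
    \<open>\<beta> ^ k\<close> starting in the window contains the half-length interval that begins
    there, so one strip crosses all the cylinders counted.\<close>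
  define a where "a = \<beta> ^ m * (c + \<beta> ^ k / 2)"
  define E where "E = {z \<in> F. fst z \<in> {a..a + \<alpha> ^ m} \<and> snd z \<in> {0..\<alpha> ^ m}}"
  have pos_v: "pos b (v @ w) = b ^ m * pos b w" for b w
    by (simp add: v_def pos_append pos_replicate_False)
  have "card ((@) v ` W) * \<alpha> ^ m \<le> 10 * \<alpha> ^ (m + k) * covering_number (\<alpha> ^ (m + k)) E"
  proof (rule covering_number_lower[where a = "\<lambda>_. a"])
    show "(@) v ` W \<subseteq> words (m + k)" by (auto simp: W_def words_def v_def)
    show "bounded E" using bounded_F by (rule bounded_subset) (auto simp: E_def)
    show "{a..a + \<alpha> ^ m} \<subseteq> {pos \<beta> u..pos \<beta> u + \<beta> ^ (m + k)}" if u: "u \<in> (@) v ` W" for u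
    proof -
      obtain w where w: "u = v @ w" "c \<le> pos \<beta> w" "pos \<beta> w \<le> c + \<beta> ^ k / 2"
        using u by (auto simp: W_def)
      then have "\<beta> ^ m * pos \<beta> w \<le> \<beta> ^ m * (c + \<beta> ^ k / 2)" "\<beta> ^ m * c \<le> \<beta> ^ m * pos \<beta> w"
        using pw by (auto intro: mult_left_mono)
      then show ?thesis
        using m by (auto simp: w(1) pos_v a_def power_add algebra_simps)
    qed
    fix u z assume u: "u \<in> (@) v ` W" "z \<in> cyl u ` F" "fst z \<in> {a..a + \<alpha> ^ m}"
    then obtain w where w: "u = v @ w" "w \<in> words k" by (auto simp: W_def)
    have "snd z \<in> {pos \<alpha> u..pos \<alpha> u + \<alpha> ^ (m + k)}"
      using u(2) snd_cyl[of u "m + k"] w by (auto simp: words_def v_def)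
    moreover have "0 \<le> pos \<alpha> w" "pos \<alpha> w \<le> 1 - \<alpha> ^ k"
      using pos_bounds[of \<alpha> w] \<alpha> w by (auto simp: words_def)
    then have "0 \<le> \<alpha> ^ m * pos \<alpha> w" "\<alpha> ^ m * pos \<alpha> w \<le> \<alpha> ^ m * (1 - \<alpha> ^ k)"
      using pw by (auto intro: mult_left_mono)
    ultimately have "snd z \<in> {0..\<alpha> ^ m}"
      by (auto simp: w pos_v power_add algebra_simps)
    then show "z \<in> E" using u cyl_in_F by (auto simp: E_def)
  qed (use pw in auto)
  moreover have "card ((@) v ` W) = card W" by (intro card_image) (auto simp: inj_on_def)
  ultimately have "card W * \<alpha> ^ m \<le> 10 * \<alpha> ^ (m + k) * covering_number (\<alpha> ^ (m + k)) E"
    by simp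
  then have 1: "card W \<le> 10 * \<alpha> ^ k * covering_number (\<alpha> ^ (m + k)) E"
    using pw by (simp add: power_add field_simps)
  have 2: "real (covering_number (\<alpha> ^ (m + k)) E) \<le> C * (3 powr u * (1 / \<alpha> ^ k) powr u)"
  \<comment> \<open>If no word is counted, \<open>E\<close> may be empty and offers no centre for a
    ball.\<close>
  proof (cases "E = {}")
    case True
    have "covering_number (\<alpha> ^ (m + k)) ({} :: (real \<times> real) set) \<le> card ({} :: (real \<times> real) set set)"
      by (intro covering_number_le) (auto simp: fine_cover_def)
    then show ?thesis using True \<open>0 < C\<close> by simp
  next
    case False
    then obtain z where z: "z \<in> E" by blast
    have "E \<subseteq> ball z (3 * \<alpha> ^ m) \<inter> F"
    proof
      fix q assume q: "q \<in> E"
      have "dist z q \<le> \<bar>fst z - fst q\<bar> + \<bar>snd z - snd q\<bar>"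
        using dist_Pair_le[of "fst z" "snd z" "fst q" "snd q"] by simp
      also have "\<dots> \<le> \<alpha> ^ m + \<alpha> ^ m"
        using z q by (auto simp: E_def)
      finally have "dist z q < 3 * \<alpha> ^ m" using pw by simp
      with q show "q \<in> ball z (3 * \<alpha> ^ m) \<inter> F" by (auto simp: E_def)
    qed
    then have "covering_number (\<alpha> ^ (m + k)) E \<le> covering_number (\<alpha> ^ (m + k)) (ball z (3 * \<alpha> ^ m) \<inter> F)"
      using \<alpha> by (intro covering_number_mono) auto
    also have "real \<dots> \<le> C * (3 * \<alpha> ^ m / \<alpha> ^ (m + k)) powr u"
    proof (rule C)
      have "\<alpha> ^ (m + k) \<le> \<alpha> ^ m" using \<alpha> by (intro power_decreasing) auto
      then show "\<alpha> ^ (m + k) < 3 * \<alpha> ^ m" using pw by linarith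
      show "z \<in> F" using z by (simp add: E_def)
    qed (use \<alpha> in auto)
    also have "3 * \<alpha> ^ m / \<alpha> ^ (m + k) = 3 * (1 / \<alpha> ^ k)"
      using \<alpha>(1) by (simp add: power_add)
    also have "(3 * (1 / \<alpha> ^ k)) powr u = 3 powr u * (1 / \<alpha> ^ k) powr u"
      by (rule powr_mult)
    finally show ?thesis by simp
  qed
  have "card W \<le> 10 * \<alpha> ^ k * (C * (3 powr u * (1 / \<alpha> ^ k) powr u))"
    by (rule order_trans[OF 1 mult_left_mono[OF 2]]) (use pw in auto)
  then show ?thesis by (simp add: W_def mult_ac)
qed

lemma expo_double_powr: "expo (2 * \<beta> powr s) = (ln 2 + s * ln \<beta>) / (- ln \<alpha>)"
  using \<beta>_pos by (simp add: expo_def ln_mult ln_powr)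

text \<open>Write \<open>u = 1 + expo (2 * \<beta> powr t)\<close> and recover the Frostman
  condition with exponent \<open>t\<close> from the count of words in windows; then \<open>t\<close>
  is at most the supremum, and \<open>expo (2 * \<beta> powr t)\<close> decreases in
  \<open>t\<close>.\<close>

lemma assouad_set_lower:
  assumes u: "u \<in> assouad_set F"
  shows "1 + expo (2 * \<beta> powr frostman_exponent \<beta>) \<le> u"
proof -
  obtain C where C: "0 < C" "\<And>r R z. 0 < r \<Longrightarrow> r < R \<Longrightarrow> z \<in> F \<Longrightarrow>
      real (covering_number r (ball z R \<inter> F)) \<le> C * (R / r) powr u"
    using u by (auto simp: assouad_set_def)
  have ln_\<beta>: "ln \<beta> < 0" using \<beta> by simp
  define t where "t = ((u - 1) * (- ln \<alpha>) - ln 2) / ln \<beta>"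
  have ut: "u = 1 + expo (2 * \<beta> powr t)"
    using ln_\<alpha> ln_\<beta> by (simp add: expo_double_powr t_def)
  \<comment> \<open>The 40 is four windows times the constant 10 of the strip count. As
    \<open>t\<close> may be negative, the last factor covers both signs: rounding the length costs
    \<open>\<beta> powr - t\<close> if \<open>t \<ge> 0\<close> and nothing otherwise.\<close>
  define D where "D = 40 * C * 3 powr u * (1 + \<beta> powr - t)"
  have D: "0 < D" using C(1) \<beta>_pos by (auto simp: D_def intro!: mult_pos_pos add_pos_pos)
  have window: "measure (bernoulli_conv \<beta>) {a..b} \<le> D * (b - a) powr t" if ab: "0 \<le> a" "a < b" "b \<le> 1" for a b
  proof -
    obtain k where k: "\<beta> ^ Suc k < b - a" "b - a \<le> \<beta> ^ k"
      using exists_power_bracket[of \<beta> "b - a"] \<beta> ab by auto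
    have bk: "0 < \<beta> ^ k" using \<beta>_pos by simp
    \<comment> \<open>Intervals that meet \<open>{a..b}\<close> start within
      \<open>\<beta> ^ k\<close> of \<open>a\<close>; four windows of length
      \<open>\<beta> ^ k / 2\<close> cover this range.\<close>
    define P where "P i = {w \<in> words k. pos \<beta> w \<in> {(a - \<beta> ^ k) + real i * (\<beta> ^ k / 2)..(a - \<beta> ^ k) + real i * (\<beta> ^ k / 2) + \<beta> ^ k / 2}}" for i
    define X where "X = 10 * C * 3 powr u * \<alpha> ^ k * (1 / \<alpha> ^ k) powr u"
    have P: "real (card (P i)) \<le> X" for i
      unfolding P_def X_def by (rule card_words_window_le[OF C(2,1)])
    have sub: "{w \<in> words k. {a..b} \<inter> {pos \<beta> w..pos \<beta> w + \<beta> ^ k} \<noteq> {}} \<subseteq> (\<Union>i\<in>{0,1,2,3}. P i)"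
    proof
      fix w assume "w \<in> {w \<in> words k. {a..b} \<inter> {pos \<beta> w..pos \<beta> w + \<beta> ^ k} \<noteq> {}}"
      then have w: "w \<in> words k" "a - \<beta> ^ k \<le> pos \<beta> w" "pos \<beta> w \<le> a + \<beta> ^ k"
        using k by auto
      then show "w \<in> (\<Union>i\<in>{0,1,2,3}. P i)"
        unfolding P_def by (simp add: algebra_simps) linarith
    qed
    have fin: "finite (P i)" for i by (simp add: P_def)
    have "card {w \<in> words k. {a..b} \<inter> {pos \<beta> w..pos \<beta> w + \<beta> ^ k} \<noteq> {}} \<le> card (\<Union>i\<in>{0,1,2,3}. P i)"
      using fin by (intro card_mono[OF _ sub]) auto
    also have "\<dots> \<le> (\<Sum>i\<in>{0,1,2,3}. card (P i))" by (rule card_UN_le) auto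
    finally have "real (card {w \<in> words k. {a..b} \<inter> {pos \<beta> w..pos \<beta> w + \<beta> ^ k} \<noteq> {}}) \<le> (\<Sum>i\<in>{0,1,2,3}. real (card (P i)))"
      unfolding of_nat_sum[symmetric] of_nat_le_iff .
    also have "\<dots> \<le> (\<Sum>i\<in>{0,1,2,3::nat}. X)" by (intro sum_mono P)
    also have "\<dots> = 4 * X" by simp
    finally have "measure (bernoulli_conv \<beta>) {a..b} \<le> 4 * X / 2 ^ k"
      using \<nu>.measure_le_card_words[of "{a..b}" k] by (smt (verit, best) divide_right_mono atLeastAtMost_borel zero_le_power)
    also have "4 * X / 2 ^ k = 40 * C * 3 powr u * (\<beta> ^ k) powr t"
    proof -
      have "(1 / \<alpha> ^ k) powr u = (2 * \<beta> powr t / \<alpha>) ^ k"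
        unfolding ut using \<beta>_pos by (intro expo_powr_Suc) auto
      also have "\<dots> = 2 ^ k * (\<beta> ^ k) powr t / \<alpha> ^ k"
      proof -
        have "(\<beta> powr t) ^ k = (\<beta> ^ k) powr t"
          using \<beta>_pos by (simp add: powr_powr mult.commute flip: powr_realpow)
        then show ?thesis by (simp add: power_mult_distrib power_divide)
      qed
      finally show ?thesis using \<alpha> by (simp add: X_def)
    qed
    also have "(\<beta> ^ k) powr t \<le> (1 + \<beta> powr - t) * (b - a) powr t"
    proof (cases "0 \<le> t")
      case True
      have "(\<beta> ^ k) powr t \<le> ((b - a) / \<beta>) powr t"
        using k True bk \<beta>_pos by (intro powr_mono2) (auto simp: field_simps)
      also have "\<dots> = \<beta> powr - t * (b - a) powr t"
        using ab \<beta>_pos by (simp add: powr_divide powr_minus field_simps)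
      finally show ?thesis by (simp add: distrib_right add_increasing)
    next
      case False
      have "(\<beta> ^ k) powr t \<le> (b - a) powr t"
        using k False ab by (intro powr_mono2') auto
      then show ?thesis by (simp add: distrib_right add_increasing2)
    qed
    finally show ?thesis using C(1) by (simp add: D_def mult_left_mono mult.assoc)
  qed
  have "t \<in> frostman_set \<beta>"
    unfolding frostman_set_def
  proof (intro CollectI exI[of _ D] conjI allI impI)
    fix I :: "real set" assume I: "is_interval I \<and> I \<subseteq> {0..1}"
    show "measure (bernoulli_conv \<beta>) I \<le> D * measure lborel I powr t"
    proof (cases "I = {}")
      case False
      then obtain a b where ab: "0 \<le> a" "a \<le> b" "b \<le> 1" "I \<subseteq> {a..b}" "measure lborel I = b - a"
        using interval_unit_bounds I by metis
      have "measure (bernoulli_conv \<beta>) I \<le> measure (bernoulli_conv \<beta>) {a..b}"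
        using ab by (intro \<nu>.finite_measure_mono) auto
      also have "\<dots> \<le> D * (b - a) powr t"
        using window[of a b] bernoulli_singleton[OF \<beta>_pos \<beta>(2)] ab by (cases "a = b") auto
      finally show ?thesis using ab by simp
    qed auto
  qed (rule D)
  then have "t \<le> frostman_exponent \<beta>"
    using le_frostman_exponent \<beta>_pos \<beta> by blast
  then have "expo (2 * \<beta> powr frostman_exponent \<beta>) \<le> expo (2 * \<beta> powr t)"
    unfolding expo_double_powr using ln_\<alpha> ln_\<beta> by (intro divide_right_mono) (auto intro: mult_right_mono_neg)
  then show ?thesis using ut by simp
qed

lemma assouad_dim_F: "assouad_dim F = 1 + expo (2 * \<beta> powr frostman_exponent \<beta>)"
proof (rule antisym)
  define s where "s = frostman_exponent \<beta>"
  have s: "1/2 < s" using frostman_exponent_gt_half \<beta> by (simp add: s_def)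
  have upper: "assouad_dim F \<le> 1 + expo (2 * \<beta> powr t)" if "t \<in> frostman_set \<beta>" "0 \<le> t" for t
    unfolding assouad_dim_eq
    using assouad_set_upper[OF that] assouad_set_lower by (intro cInf_lower) (auto intro!: bdd_belowI)
  show "assouad_dim F \<le> 1 + expo (2 * \<beta> powr frostman_exponent \<beta>)"
  \<comment> \<open>The supremum need not belong to the Frostman set, so the bound is taken at
    exponents just below it and passed to the limit.\<close>
  proof (rule tendsto_lowerbound)
    show "((\<lambda>e. 1 + expo (2 * \<beta> powr (s - e))) \<longlongrightarrow> 1 + expo (2 * \<beta> powr frostman_exponent \<beta>)) (at_right 0)"
    proof -
      have "((\<lambda>e. 1 + ln (2 * \<beta> powr (s - e)) / (- ln \<alpha>)) \<longlongrightarrow> 1 + ln (2 * \<beta> powr (s - 0)) / (- ln \<alpha>)) (at_right 0)"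
        using \<beta>_pos ln_\<alpha> by (intro tendsto_intros) auto
      then show ?thesis by (simp add: expo_def s_def)
    qed
    have "eventually (\<lambda>e. e \<in> {0<..<s}) (at_right 0)"
      using s by (intro eventually_at_right_real) auto
    then show "eventually (\<lambda>e. assouad_dim F \<le> 1 + expo (2 * \<beta> powr (s - e))) (at_right 0)"
    proof eventually_elim
      case (elim e)
      obtain t where t: "t \<in> frostman_set \<beta>" "s - e < t"
        using less_cSupE[of "s - e" "frostman_set \<beta>"] elim frostman_set_nonempty \<beta>_pos \<beta>
        unfolding s_def frostman_exponent_eq by auto
      have "\<beta> powr t \<le> \<beta> powr (s - e)"
        using \<beta> t by (intro powr_mono') auto
      then have "expo (2 * \<beta> powr t) \<le> expo (2 * \<beta> powr (s - e))"
        unfolding expo_def using ln_\<alpha> \<beta>_pos by (intro divide_right_mono) auto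
      then show ?case using upper[OF t(1)] t elim by auto
    qed
  qed auto
  show "1 + expo (2 * \<beta> powr frostman_exponent \<beta>) \<le> assouad_dim F"
  proof -
    have "\<exists>t\<in>frostman_set \<beta>. 1/2 < t"
      using less_cSupE[of "1/2" "frostman_set \<beta>"] s frostman_set_nonempty \<beta>_pos \<beta>
      unfolding s_def frostman_exponent_eq by blast
    then have "assouad_set F \<noteq> {}" using assouad_set_upper by force
    then show ?thesis
      unfolding assouad_dim_eq using assouad_set_lower by (intro cInf_greatest) auto
  qed
qed

text \<open>All three follow from \<open>(ln 2 + s * ln \<beta>) / (- ln \<alpha>)\<close>:
  positivity from \<open>s \<le> 1\<close> and \<open>\<beta> > 1/2\<close>, the middle inequality
  from \<open>s > 1/2\<close>, the last from \<open>ln 2 \<le> - ln \<alpha>\<close> and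
  \<open>ln \<beta> < 0\<close>.\<close>

lemma dimension_bounds:
  "1 < assouad_dim F"
  "1 + expo (2 * \<beta> powr frostman_exponent \<beta>) < 1 + ln 2 / (- ln \<alpha>) - ln \<beta> / (2 * ln \<alpha>)"
  "1 + ln 2 / (- ln \<alpha>) - ln \<beta> / (2 * ln \<alpha>) < 2"
proof -
  define s where "s = frostman_exponent \<beta>"
  have s: "1/2 < s" "s \<le> 1"
    using frostman_exponent_gt_half frostman_exponent_le_1 \<beta> \<beta>_pos by (auto simp: s_def)
  have ln_\<beta>: "- ln 2 < ln \<beta>" "ln \<beta> < 0"
    using \<beta> ln_less_cancel_iff[of "1/2" \<beta>] by (auto simp: ln_div)
  have "ln \<alpha> \<le> ln (1/2)" using \<alpha> by (subst ln_le_cancel_iff) auto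
  then have ln2: "ln 2 \<le> - ln \<alpha>" by (simp add: ln_div)
  have "1 * ln \<beta> \<le> s * ln \<beta>" using s ln_\<beta> by (intro mult_right_mono_neg) auto
  then have "0 < ln 2 + s * ln \<beta>" using ln_\<beta> by linarith
  then show "1 < assouad_dim F"
    using ln_\<alpha> unfolding assouad_dim_F expo_double_powr s_def[symmetric]
    by (simp only: less_add_same_cancel1) (rule divide_pos_pos; simp)
  have eq: "1 + ln 2 / (- ln \<alpha>) - ln \<beta> / (2 * ln \<alpha>) = 1 + (ln 2 + 1/2 * ln \<beta>) / (- ln \<alpha>)"
    using ln_\<alpha> by (simp add: field_simps)
  have "s * ln \<beta> < 1/2 * ln \<beta>" using s ln_\<beta> by (intro mult_strict_right_mono_neg) auto
  then show "1 + expo (2 * \<beta> powr frostman_exponent \<beta>) < 1 + ln 2 / (- ln \<alpha>) - ln \<beta> / (2 * ln \<alpha>)"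
    unfolding eq expo_double_powr s_def[symmetric] using ln_\<alpha>
    by (intro add_strict_left_mono divide_strict_right_mono) auto
  have "ln 2 + 1/2 * ln \<beta> < - ln \<alpha>" using ln2 ln_\<beta> by simp
  then have "(ln 2 + 1/2 * ln \<beta>) / (- ln \<alpha>) < 1"
    using ln_\<alpha> by (subst pos_divide_less_eq) auto
  then show "1 + ln 2 / (- ln \<alpha>) - ln \<beta> / (2 * ln \<alpha>) < 2"
    unfolding eq by simp
qed

text \<open>The box dimension is the Assouad formula with exponent 1 in place of
  \<open>frostman_exponent \<beta>\<close>, so convergence of the exponent to 1 closes the
  gap.\<close>

lemma assouad_dim_minus_box_dim:
  "assouad_dim F - box_dim F = (frostman_exponent \<beta> - 1) * ln \<beta> / (- ln \<alpha>)"
proof -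
  have "box_dim F = 1 + expo (2 * \<beta> powr 1)"
    using box_dim_F \<beta>_pos by simp
  then show ?thesis
    unfolding assouad_dim_F expo_double_powr
    by (simp only: add_diff_cancel_left diff_divide_distrib[symmetric] left_diff_distrib)
qed

end

theorem corollary2p5:
  fixes \<alpha> :: real
  assumes "0 < \<alpha>" and "\<alpha> \<le> 1/2"
  shows "(\<forall>\<beta>::real. 1/2 < \<beta> \<and> \<beta> < 1 \<longrightarrow>
            1 < assouad_dim (attractor \<alpha> \<beta>) \<and>
            assouad_dim (attractor \<alpha> \<beta>) =
              1 + ln (2 * \<beta> powr frostman_exponent \<beta>) / (- ln \<alpha>) \<and>
            1 + ln (2 * \<beta> powr frostman_exponent \<beta>) / (- ln \<alpha>)
              < 1 + ln 2 / (- ln \<alpha>) - ln \<beta> / (2 * ln \<alpha>) \<and>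
            1 + ln 2 / (- ln \<alpha>) - ln \<beta> / (2 * ln \<alpha>) < 2) \<and>
         (\<forall>n::nat. 1 \<le> n \<longrightarrow>
            ((\<lambda>\<beta>. assouad_dim (attractor \<alpha> \<beta>) - box_dim (attractor \<alpha> \<beta>)) \<longlongrightarrow> 0)
              (at (2 powr (- 1 / real n)) within {1/2<..<1}))"
proof (intro conjI allI impI)
  fix \<beta> :: real assume "1/2 < \<beta> \<and> \<beta> < 1"
  then interpret carpet \<alpha> \<beta> using assms by unfold_locales auto
  show "1 < assouad_dim (attractor \<alpha> \<beta>)"
    "assouad_dim (attractor \<alpha> \<beta>) = 1 + ln (2 * \<beta> powr frostman_exponent \<beta>) / (- ln \<alpha>)"
    "1 + ln (2 * \<beta> powr frostman_exponent \<beta>) / (- ln \<alpha>) < 1 + ln 2 / (- ln \<alpha>) - ln \<beta> / (2 * ln \<alpha>)"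
    "1 + ln 2 / (- ln \<alpha>) - ln \<beta> / (2 * ln \<alpha>) < 2"
    using dimension_bounds assouad_dim_F by (simp_all only: expo_def)
next
  fix n :: nat assume n: "1 \<le> n"
  let ?b = "2 powr (- 1 / real n) :: real"
  let ?F = "at ?b within {1/2<..<1}"
  have "((\<lambda>\<beta>. (frostman_exponent \<beta> - 1) * ln \<beta> / (- ln \<alpha>)) \<longlongrightarrow> (1 - 1) * ln ?b / (- ln \<alpha>)) ?F"
    using assms
    by (intro tendsto_divide tendsto_mult tendsto_diff tendsto_const tendsto_ln
        frostman_exponent_tendsto_1[OF n] tendsto_ident_at) auto
  moreover have "eventually (\<lambda>\<beta>. (frostman_exponent \<beta> - 1) * ln \<beta> / (- ln \<alpha>)
      = assouad_dim (attractor \<alpha> \<beta>) - box_dim (attractor \<alpha> \<beta>)) ?F"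
  proof -
    have "eventually (\<lambda>\<beta>. \<beta> \<in> {1/2<..<1}) ?F"
      by (auto simp: eventually_at_filter)
    then show ?thesis
    proof eventually_elim
      case (elim \<beta>)
      then interpret carpet \<alpha> \<beta> using assms by unfold_locales auto
      show ?case by (rule assouad_dim_minus_box_dim[symmetric])
    qed
  qed
  ultimately show "((\<lambda>\<beta>. assouad_dim (attractor \<alpha> \<beta>) - box_dim (attractor \<alpha> \<beta>)) \<longlongrightarrow> 0) ?F"
    by (auto dest: Lim_transform_eventually)
qed

end
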